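(* Let $n\ge 1$ and let $\mathcal{L}^n$ be the $n$-dimensional Lebesgue measure. For any closed subset $\Omega\subset[0,1]^n$ with $\mathcal{L}^n(\Omega)>0$, let $B_\Omega\subset[0,1]^n$ be a metric ball (with respect to the $l^1$-distance) centered at the origin with $\mathcal{L}^n(B_\Omega)=\mathcal{L}^n(\Omega)$. Then \[ \mathcal{L}^n|_{[0,1]^n}(U_r(\Omega))\ge\mathcal{L}^n|_{[0,1]^n}(U_r(B_\Omega)) \] for any $r>0$.
   Context: $[0,1]^n$ is equipped with the $l^1$-distance $d_{l^1}(x,y)=\sum_{i=1}^n|x_i-y_i|$. For $A\subset[0,1]^n$ and $r>0$, $U_r(A):=\{x\in[0,1]^n\mid d_{l^1}(x,A)<r\}$ is the open $r$-neighborhood of $A$, where $d_{l^1}(x,A)=\inf_{y\in A}d_{l^1}(x,y)$. *)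

theory Defs
  imports "HOL-Analysis.Analysis"
begin

definition unit_cube :: "(real ^ 'n) set" where
  "unit_cube = {x. \<forall>i. 0 \<le> x $ i \<and> x $ i \<le> 1}"

definition l1_dist :: "real ^ 'n \<Rightarrow> real ^ 'n \<Rightarrow> real" where
  "l1_dist x y = (\<Sum>i\<in>UNIV. \<bar>x $ i - y $ i\<bar>)"

lemma Metric_space_unit_cube: "Metric_space (unit_cube :: (real ^ 'n) set) l1_dist"
proof
  fix x y z :: "real ^ 'n"
  show "0 \<le> l1_dist x y"
    by (simp add: l1_dist_def sum_nonneg)
  show "l1_dist x y = l1_dist y x"
    by (simp add: l1_dist_def abs_minus_commute)
  show "l1_dist x y = 0 \<longleftrightarrow> x = y"
    by (simp add: l1_dist_def sum_nonneg_eq_0_iff vec_eq_iff)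
  show "l1_dist x z \<le> l1_dist x y + l1_dist y z"
    by (auto simp: l1_dist_def simp flip: sum.distrib intro!: sum_mono)
qed

text \<open>As a real infimum this is meaningful only for nonempty \<open>A\<close>.\<close>

definition l1_infdist :: "real ^ 'n \<Rightarrow> (real ^ 'n) set \<Rightarrow> real" where
  "l1_infdist x A = (INF y\<in>A. l1_dist x y)"

definition l1_nbhd :: "real \<Rightarrow> (real ^ 'n) set \<Rightarrow> (real ^ 'n) set" where
  "l1_nbhd r A = {x \<in> unit_cube. l1_infdist x A < r}"

text \<open>Balls of the metric space \<open>(unit_cube, l1_dist)\<close>, that is, balls intersected with the cube;
  both open and closed balls are allowed.\<close>

definition is_l1_ball :: "real ^ 'n \<Rightarrow> (real ^ 'n) set \<Rightarrow> bool" where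
  "is_l1_ball c B \<longleftrightarrow>
    (\<exists>s>0. B = Metric_space.mball unit_cube l1_dist c s \<or>
           B = Metric_space.mcball unit_cube l1_dist c s)"

end

theory Submission
  imports Defs
begin

text \<open>
  The inequality is the limit, as \<open>k\<close> tends to infinity, of a vertex-isoperimetric inequality in the
  finite grid \<open>{0..<k}\<^sup>n\<close> with its \<open>l\<^sup>1\<close> graph metric (the theorem of Wang and Wang and of
  Bollobas and Leader). In the limit an additive error of boundedly many layers
  \<open>{x. \<Sum>i. x i = m}\<close> is harmless, so in the grid it
  is enough to compare with balls up to boundedly many layers.

  The discrete inequality is proved by compression. Fix two coordinates and replace each section of a
  set \<open>A\<close> in the corresponding two-dimensional fibres by the initial segment of the same size, in the
  order of \<open>{0..<k}\<^sup>2\<close> that sorts by coordinate sum and then by first coordinate. If initial segments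
  are optimal in dimension two, then no \<open>t\<close>-neighbourhood of \<open>A\<close> grows (\<open>card_nbhd_squash\<close>), while
  the sum of all coordinates over \<open>A\<close> drops unless the sections were already sorted by coordinate sum
  (\<open>improve\<close>). So among the competitors of \<open>A\<close> one that minimises that sum is stable under
  all pair compressions (\<open>compressed_exists\<close>). Stability lets one move mass between two coordinates at
  the price of lowering the coordinate sum by one; hence a stable set containing \<open>x\<close> contains every
  grid point whose coordinate sum is smaller by at least \<open>n\<close> (\<open>compressed_absorbs\<close>), that is, it is a
  discrete ball around the origin up to \<open>n\<close> layers, and balls have the expected neighbourhoods
  (\<open>grid_isoperimetry\<close>).

  The two-dimensional case must be exact, because compression needs a nested chain of optimal sets
  (\<open>iso_chain_grid2\<close>). Compression in a single coordinate makes a minimiser a down-set. If a down-set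
  misses a point that is strictly lower than one of its points, then exchanging a suitable boundary
  point of its top level for one of its lowest incomplete level does not enlarge the neighbourhood
  (\<open>unsorted_improvable\<close>). What remains is a full ball plus part of one level, for which
  points packed at one end of the level are optimal (\<open>card_nbhd_initial2_le\<close>).

  For the passage to the limit, the cube is cut into cells of side \<open>1 / k\<close>. The cells that meet
  \<open>\<Omega>\<close> cover it up to a null set, the cells within grid distance \<open>t\<close> of those lie in the
  \<open>r\<close>-neighbourhood of \<open>\<Omega>\<close> once \<open>t + n < r k\<close>, and discrete balls are squeezed between corner
  simplices. The total loss is a shift of the radius by \<open>(3 n + 3) / k\<close>
  (\<open>corner_enlargement_approx\<close>), and letting \<open>k\<close> grow finishes the proof.
\<close>

section \<open>Compression in a product graph\<close>

definition nbhd :: "'a set \<Rightarrow> ('a \<Rightarrow> 'a \<Rightarrow> bool) \<Rightarrow> 'a set \<Rightarrow> 'a set" where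
  "nbhd X R A = {x \<in> X. \<exists>y\<in>A. R y x}"

lemma nbhd_mono: "A \<subseteq> B \<Longrightarrow> nbhd X R A \<subseteq> nbhd X R B"
  unfolding nbhd_def by blast

lemma nbhd_subset: "nbhd X R A \<subseteq> X"
  unfolding nbhd_def by blast

lemma nbhd_funpow_subset: "A \<subseteq> X \<Longrightarrow> (nbhd X R ^^ t) A \<subseteq> X"
  by (cases t) (auto simp: nbhd_def)

text \<open>
  One inclusion in the last conjunct says two things: the set \<open>I v\<close> has the smallest neighbourhood
  among sets of size \<open>v\<close>, and its neighbourhood is contained in another member of the chain.
\<close>

definition iso_chain :: "'a set \<Rightarrow> ('a \<Rightarrow> 'a \<Rightarrow> bool) \<Rightarrow> (nat \<Rightarrow> 'a set) \<Rightarrow> bool" where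
  "iso_chain X R I \<longleftrightarrow> finite X \<and> mono I \<and> (\<forall>v. I v \<subseteq> X) \<and> (\<forall>v\<le>card X. card (I v) = v) \<and>
     (\<forall>S\<subseteq>X. nbhd X R (I (card S)) \<subseteq> I (card (nbhd X R S)))"

text \<open>
  If \<open>\<theta>\<close> is the largest value of \<open>f\<close> on \<open>J\<close>, then passing from \<open>J\<close> to \<open>D\<close> exchanges points of
  value at most \<open>\<theta>\<close> for equally many points of value at least \<open>\<theta>\<close>. Equality forces every exchanged
  point to have value exactly \<open>\<theta>\<close>.
\<close>

lemma sum_sorted_le:
  fixes f :: "'a \<Rightarrow> nat"
  assumes fin: "finite X" and JX: "J \<subseteq> X" and DX: "D \<subseteq> X" and card: "card J = card D"
    and sorted: "\<And>p q. p \<in> J \<Longrightarrow> q \<in> X - J \<Longrightarrow> f p \<le> f q"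
  shows "sum f J \<le> sum f D"
    and "\<lbrakk>x \<in> D; y \<in> X - D; f y < f x\<rbrakk> \<Longrightarrow> sum f J < sum f D"
proof -
  have fJ: "finite J" and fD: "finite D"
    using fin JX DX finite_subset by auto
  define \<theta> where "\<theta> = (if J = {} then 0 else Max (f ` J))"
  have low: "f p \<le> \<theta>" if "p \<in> J" for p
    using that fJ by (auto simp: \<theta>_def)
  have high: "\<theta> \<le> f q" if "q \<in> X - J" for q
  proof (cases "J = {}")
    case False
    then have "Max (f ` J) \<in> f ` J" using fJ by (intro Max_in) auto
    then show ?thesis using sorted that False by (auto simp: \<theta>_def)
  qed (simp add: \<theta>_def)
  have cd: "card (J - D) = card (D - J)"
    using card fJ fD by (metis card_Diff_subset_Int finite_Int inf_commute)
  have split: "sum f J = sum f (J \<inter> D) + sum f (J - D)" "sum f D = sum f (J \<inter> D) + sum f (D - J)"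
    using sum.Int_Diff[OF fJ, of f D] sum.Int_Diff[OF fD, of f J] by (simp_all add: Int_commute)
  have a: "sum f (J - D) \<le> card (J - D) * \<theta>"
    using sum_bounded_above[of "J - D" f \<theta>] low by simp
  have b: "card (J - D) * \<theta> \<le> sum f (D - J)"
    using sum_bounded_below[of "D - J" \<theta> f] high DX cd by auto
  show "sum f J \<le> sum f D" using split a b by linarith
  assume x: "x \<in> D" and y: "y \<in> X - D" and lt: "f y < f x"
  have "sum f (J - D) < card (J - D) * \<theta> \<or> card (J - D) * \<theta> < sum f (D - J)"
  proof (cases "f y < \<theta>")
    case True
    then have "y \<in> J - D" using y high[of y] by (meson Diff_iff leD)
    then have "sum f (J - D) < (\<Sum>p\<in>J - D. \<theta>)"
      using fJ low True by (intro sum_strict_mono_ex1) auto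
    then show ?thesis by simp
  next
    case False
    then have "\<theta> < f x" using lt by simp
    then have "x \<in> D - J" using x low[of x] by (meson Diff_iff leD)
    then have "(\<Sum>p\<in>D - J. \<theta>) < sum f (D - J)"
      using fD DX high \<open>\<theta> < f x\<close> by (intro sum_strict_mono_ex1) auto
    then show ?thesis using cd by simp
  qed
  then show "sum f J < sum f D" using split a b by linarith
qed

text \<open>
  A graph \<open>P\<close> presented as a Cartesian product: \<open>c\<close> is the coordinate in the factor \<open>X\<close> that is to be
  compressed, and \<open>\<pi>\<close> names the fibre. Carrying the product structure by two maps
  instead of by pairs allows the grid to be compressed along any choice of coordinates without
  changing its type.
\<close>

locale compression =
  fixes P :: "'p set" and R :: "'p \<Rightarrow> 'p \<Rightarrow> bool"
    and X :: "'a set" and R1 :: "'a \<Rightarrow> 'a \<Rightarrow> bool" and R2 :: "'z \<Rightarrow> 'z \<Rightarrow> bool"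
    and c :: "'p \<Rightarrow> 'a" and \<pi> :: "'p \<Rightarrow> 'z" and I :: "nat \<Rightarrow> 'a set"
  assumes fin: "finite P"
    and bij: "bij_betw (\<lambda>x. (c x, \<pi> x)) P (X \<times> \<pi> ` P)"
    and adj: "\<And>x y. x \<in> P \<Longrightarrow> y \<in> P \<Longrightarrow>
               R x y \<longleftrightarrow> R1 (c x) (c y) \<and> \<pi> x = \<pi> y \<or> c x = c y \<and> R2 (\<pi> x) (\<pi> y)"
    and chain: "iso_chain X R1 I"
begin

definition sect :: "'p set \<Rightarrow> 'z \<Rightarrow> 'a set" where
  "sect A z = c ` {x \<in> A. \<pi> x = z}"

definition squash :: "'p set \<Rightarrow> 'p set" where
  "squash A = {x \<in> P. c x \<in> I (card (sect A (\<pi> x)))}"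

lemma finX: "finite X" and monoI: "v \<le> w \<Longrightarrow> I v \<subseteq> I w" and IX: "I v \<subseteq> X"
  and cardI: "v \<le> card X \<Longrightarrow> card (I v) = v"
  and chain_nbhd: "S \<subseteq> X \<Longrightarrow> nbhd X R1 (I (card S)) \<subseteq> I (card (nbhd X R1 S))"
  using chain unfolding iso_chain_def by (blast, blast dest: monoD, blast, blast, blast)

lemma c_in: "x \<in> P \<Longrightarrow> c x \<in> X"
  using bij_betwE[OF bij] by blast

lemma point_eqI: "x \<in> P \<Longrightarrow> y \<in> P \<Longrightarrow> c x = c y \<Longrightarrow> \<pi> x = \<pi> y \<Longrightarrow> x = y"
  by (rule inj_onD[OF bij_betw_imp_inj_on[OF bij]]) simp_all

lemma point_exists: "a \<in> X \<Longrightarrow> x \<in> P \<Longrightarrow> \<exists>y\<in>P. c y = a \<and> \<pi> y = \<pi> x"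
proof -
  assume "a \<in> X" "x \<in> P"
  then have "(a, \<pi> x) \<in> (\<lambda>x. (c x, \<pi> x)) ` P"
    using bij_betw_imp_surj_on[OF bij] by blast
  then obtain y where "(a, \<pi> x) = (c y, \<pi> y)" "y \<in> P"
    by (rule imageE)
  then show ?thesis by (intro bexI[of _ y]) simp_all
qed

lemma sect_subset: "A \<subseteq> P \<Longrightarrow> sect A z \<subseteq> X"
  unfolding sect_def using c_in by blast

lemma sect_finite: "A \<subseteq> P \<Longrightarrow> finite (sect A z)"
  by (rule finite_subset[OF sect_subset finX])

lemma sect_squash:
  assumes x: "x \<in> P"
  shows "sect (squash A) (\<pi> x) = I (card (sect A (\<pi> x)))"
proof
  show "sect (squash A) (\<pi> x) \<subseteq> I (card (sect A (\<pi> x)))"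
  proof
    fix a assume "a \<in> sect (squash A) (\<pi> x)"
    then obtain y where "y \<in> squash A" "\<pi> y = \<pi> x" "a = c y"
      unfolding sect_def by blast
    then show "a \<in> I (card (sect A (\<pi> x)))" by (simp add: squash_def)
  qed
  show "I (card (sect A (\<pi> x))) \<subseteq> sect (squash A) (\<pi> x)"
  proof
    fix a assume a: "a \<in> I (card (sect A (\<pi> x)))"
    then have "a \<in> X" using IX by blast
    then obtain y where y: "y \<in> P" "c y = a" "\<pi> y = \<pi> x" using point_exists x by blast
    then have "y \<in> squash A" using a unfolding squash_def by simp
    then show "a \<in> sect (squash A) (\<pi> x)" using y unfolding sect_def by blast
  qed
qed

lemma card_sect_le: "A \<subseteq> B \<Longrightarrow> B \<subseteq> P \<Longrightarrow> card (sect A z) \<le> card (sect B z)"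
  by (rule card_mono[OF sect_finite]) (auto simp: sect_def)

lemma squash_subset: "squash A \<subseteq> P"
  unfolding squash_def by blast

lemma card_sect_squash:
  assumes "A \<subseteq> P" "x \<in> P"
  shows "card (sect (squash A) (\<pi> x)) = card (sect A (\<pi> x))"
  unfolding sect_squash[OF assms(2)] by (rule cardI[OF card_mono[OF finX sect_subset[OF assms(1)]]])

lemma sum_fibres:
  fixes h :: "'p \<Rightarrow> nat"
  assumes "A \<subseteq> P"
  shows "sum h A = (\<Sum>z\<in>\<pi> ` P. sum h {x \<in> A. \<pi> x = z})"
proof -
  have "finite A" using assms fin finite_subset by blast
  moreover have "\<pi> ` A \<subseteq> \<pi> ` P" using assms by blast
  ultimately show ?thesis using sum.group[of A "\<pi> ` P" \<pi> h] fin by simp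
qed

lemma card_fibre: "A \<subseteq> P \<Longrightarrow> card {x \<in> A. \<pi> x = z} = card (sect A z)"
  unfolding sect_def by (rule card_image[symmetric]) (auto simp: inj_on_def intro: point_eqI)

lemma card_squash: "A \<subseteq> P \<Longrightarrow> card (squash A) = card A"
proof -
  assume A: "A \<subseteq> P"
  have "card (squash A) = (\<Sum>z\<in>\<pi> ` P. card {x \<in> squash A. \<pi> x = z})"
    using sum_fibres[OF squash_subset, of "\<lambda>_. 1"] by simp
  also have "\<dots> = (\<Sum>z\<in>\<pi> ` P. card {x \<in> A. \<pi> x = z})"
    using A card_sect_squash squash_subset by (intro sum.cong) (auto simp: card_fibre)
  also have "\<dots> = card A"
    using sum_fibres[OF A, of "\<lambda>_. 1"] by simp
  finally show ?thesis .
qed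

text \<open>
  A neighbour in the squashed set lies either in the same fibre or at the same coordinate of an adjacent
  fibre. In the first case the chain property applies to the section. In the second the section of the
  adjacent fibre sits inside the section of the neighbourhood, and the chain is nested.
\<close>

lemma nbhd_squash: "A \<subseteq> P \<Longrightarrow> nbhd P R (squash A) \<subseteq> squash (nbhd P R A)"
proof
  fix x assume A: "A \<subseteq> P" and "x \<in> nbhd P R (squash A)"
  then obtain y where x: "x \<in> P" and y: "y \<in> P" "c y \<in> I (card (sect A (\<pi> y)))" and "R y x"
    unfolding nbhd_def squash_def by blast
  let ?N = "nbhd P R A"
  have N: "?N \<subseteq> P" by (rule nbhd_subset)
  have fN: "finite (sect ?N (\<pi> x))" using sect_finite N by blast
  have "c x \<in> I (card (sect ?N (\<pi> x)))"
    using \<open>R y x\<close>[unfolded adj[OF y(1) x]]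
  proof (elim disjE conjE)
    assume R1: "R1 (c y) (c x)" and eq: "\<pi> y = \<pi> x"
    have "c x \<in> nbhd X R1 (I (card (sect A (\<pi> x))))"
      using R1 eq y c_in[OF x] unfolding nbhd_def by auto
    then have "c x \<in> I (card (nbhd X R1 (sect A (\<pi> x))))"
      using chain_nbhd[OF sect_subset[OF A]] by blast
    moreover have "nbhd X R1 (sect A (\<pi> x)) \<subseteq> sect ?N (\<pi> x)"
    proof
      fix b assume "b \<in> nbhd X R1 (sect A (\<pi> x))"
      then obtain y' where b: "b \<in> X" and y': "y' \<in> A" "\<pi> y' = \<pi> x" "R1 (c y') b"
        unfolding nbhd_def sect_def by blast
      obtain x' where x': "x' \<in> P" "c x' = b" "\<pi> x' = \<pi> x" using point_exists b x by blast
      then have "R y' x'" using adj[of y' x'] y' A by auto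
      then show "b \<in> sect ?N (\<pi> x)" using x' y' unfolding sect_def nbhd_def by blast
    qed
    ultimately show ?thesis using monoI[OF card_mono[OF fN]] by blast
  next
    assume eq: "c y = c x" and R2: "R2 (\<pi> y) (\<pi> x)"
    have "sect A (\<pi> y) \<subseteq> sect ?N (\<pi> x)"
    proof
      fix b assume "b \<in> sect A (\<pi> y)"
      then obtain y' where y': "y' \<in> A" "\<pi> y' = \<pi> y" "c y' = b"
        unfolding sect_def by blast
      then have "b \<in> X" using A c_in by auto
      then obtain x' where x': "x' \<in> P" "c x' = b" "\<pi> x' = \<pi> x" using point_exists x by blast
      then have "R y' x'" using adj[of y' x'] y' A R2 by auto
      then show "b \<in> sect ?N (\<pi> x)" using x' y' unfolding sect_def nbhd_def by blast
    qed
    then show ?thesis using monoI[OF card_mono[OF fN]] y(2) eq by auto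
  qed
  then show "x \<in> squash ?N" using x unfolding squash_def by blast
qed

lemma card_nbhd_squash:
  assumes A: "A \<subseteq> P"
  shows "card ((nbhd P R ^^ t) (squash A)) \<le> card ((nbhd P R ^^ t) A)"
proof -
  have sub: "(nbhd P R ^^ t) A \<subseteq> P" for t using nbhd_funpow_subset A by blast
  have "(nbhd P R ^^ t) (squash A) \<subseteq> squash ((nbhd P R ^^ t) A)"
  proof (induction t)
    case (Suc t)
    then show ?case using nbhd_mono[OF Suc] nbhd_squash[OF sub[of t]] by fastforce
  qed simp
  then have "card ((nbhd P R ^^ t) (squash A)) \<le> card (squash ((nbhd P R ^^ t) A))"
    using fin squash_subset finite_subset by (intro card_mono) blast+
  then show ?thesis using card_squash sub by simp
qed

text \<open>
  When every member of the chain consists of points of lowest weight in each fibre, squashing cannot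
  increase the total weight, and it strictly decreases it as soon as one section is not sorted. Minimising
  the weight over all sets with small neighbourhoods therefore sorts all sections at once.
\<close>

lemma improve:
  fixes h :: "'p \<Rightarrow> nat"
  assumes sorted: "\<And>x y v. x \<in> P \<Longrightarrow> y \<in> P \<Longrightarrow> \<pi> x = \<pi> y \<Longrightarrow> c x \<in> I v \<Longrightarrow> c y \<notin> I v \<Longrightarrow> h x \<le> h y"
    and A: "A \<subseteq> P" and x: "x \<in> A" and y: "y \<in> P - A" and fib: "\<pi> x = \<pi> y" and lt: "h y < h x"
  shows "\<exists>A'\<subseteq>P. card A' = card A \<and> sum h A' < sum h A \<and>
           (\<forall>t. card ((nbhd P R ^^ t) A') \<le> card ((nbhd P R ^^ t) A))"
proof -
  let ?f = "\<lambda>B z. {p \<in> B. \<pi> p = z}"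
  have mem: "p \<in> squash A \<longleftrightarrow> c p \<in> I (card (sect A (\<pi> p)))" if "p \<in> P" for p
    using that unfolding squash_def by simp
  have cards: "card (?f (squash A) z) = card (?f A z)" if "z \<in> \<pi> ` P" for z
    using that A card_sect_squash squash_subset by (auto simp: card_fibre)
  have srt: "h p \<le> h q" if "p \<in> ?f (squash A) z" "q \<in> ?f P z - ?f (squash A) z" for p q z
  proof (rule sorted)
    show "p \<in> P" "q \<in> P" "\<pi> p = \<pi> q" using that squash_subset by auto
    then show "c p \<in> I (card (sect A z))" "c q \<notin> I (card (sect A z))"
      using that mem[of p] mem[of q] by auto
  qed
  have le: "sum h (?f (squash A) z) \<le> sum h (?f A z)" if "z \<in> \<pi> ` P" for z
  proof (rule sum_sorted_le(1))
    show "finite (?f P z)" using fin by simp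
    show "?f (squash A) z \<subseteq> ?f P z" "?f A z \<subseteq> ?f P z" using A squash_subset by auto
  qed (fact cards[OF that], fact srt)
  have z: "\<pi> x \<in> \<pi> ` P" using x A by blast
  have "sum h (?f (squash A) (\<pi> x)) < sum h (?f A (\<pi> x))"
  proof (rule sum_sorted_le(2))
    show "finite (?f P (\<pi> x))" using fin by simp
    show "?f (squash A) (\<pi> x) \<subseteq> ?f P (\<pi> x)" "?f A (\<pi> x) \<subseteq> ?f P (\<pi> x)"
      using A squash_subset by auto
    show "x \<in> ?f A (\<pi> x)" "y \<in> ?f P (\<pi> x) - ?f A (\<pi> x)" using x y fib by auto
  qed (fact cards[OF z], fact srt, fact lt)
  then have "sum h (squash A) < sum h A"
    unfolding sum_fibres[OF A] sum_fibres[OF squash_subset]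
    using fin le z by (intro sum_strict_mono_ex1) auto
  then show ?thesis
    using squash_subset card_squash[OF A] card_nbhd_squash[OF A] by blast
qed

end

section \<open>The path and the order on the square grid\<close>

definition path_rel :: "nat \<Rightarrow> nat \<Rightarrow> bool" where
  "path_rel a b \<longleftrightarrow> a \<le> Suc b \<and> b \<le> Suc a"

lemma path_rel_refl [simp]: "path_rel a a"
  unfolding path_rel_def by simp

lemma nbhd_increasing: "(\<And>x. R x x) \<Longrightarrow> A \<subseteq> X \<Longrightarrow> A \<subseteq> nbhd X R A"
  unfolding nbhd_def by blast

text \<open>
  A nonempty proper subset of a path has a neighbour outside itself, since the path is connected.
\<close>

lemma iso_chain_path: "iso_chain {..<k} path_rel (\<lambda>v. {..<min v k})"
proof -
  have "nbhd {..<k} path_rel {..<min (card S) k} \<subseteq> {..<min (card (nbhd {..<k} path_rel S)) k}"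
    if S: "S \<subseteq> {..<k}" for S
  proof (cases "S = {}")
    case False
    let ?N = "nbhd {..<k} path_rel S"
    have SN: "S \<subseteq> ?N" using S by (intro nbhd_increasing) auto
    have finN: "finite ?N" using finite_subset[OF nbhd_subset] by blast
    have "min (Suc (card S)) k \<le> card ?N"
    proof (cases "?N = S")
      case True
      obtain s where s: "s \<in> S" using False by blast
      have stepS: "b \<in> S" if "a \<in> S" "path_rel a b" "b < k" for a b
        using that True unfolding nbhd_def by blast
      have up: "s + d < k \<Longrightarrow> s + d \<in> S" for d
      proof (induction d)
        case (Suc d)
        then show ?case using stepS[of "s + d" "s + Suc d"] by (auto simp: path_rel_def)
      qed (use s in simp)
      have down: "s - d \<in> S" for d
      proof (induction d)
        case (Suc d)
        have "s - Suc d < k" using s S by (meson diff_le_self lessThan_iff order_le_less_trans subsetD)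
        moreover have "path_rel (s - d) (s - Suc d)" unfolding path_rel_def by arith
        ultimately show ?case using stepS[OF Suc] by blast
      qed (use s in simp)
      have "{..<k} \<subseteq> S"
      proof
        fix b assume "b \<in> {..<k}"
        then show "b \<in> S" using up[of "b - s"] down[of "s - b"] by (cases "s \<le> b") auto
      qed
      then have "S = {..<k}" using S by blast
      then show ?thesis using True by simp
    next
      case False
      then have "card S < card ?N" using SN finN by (intro psubset_card_mono) auto
      then show ?thesis by simp
    qed
    then show ?thesis unfolding nbhd_def path_rel_def by auto
  qed (simp add: nbhd_def)
  then show ?thesis unfolding iso_chain_def by (auto simp: mono_def)
qed

text \<open>
  The first \<open>v\<close> points of \<open>X\<close>, counted by rank instead of by key so that the key may have gaps.
\<close>

definition initial :: "'a set \<Rightarrow> ('a \<Rightarrow> nat) \<Rightarrow> nat \<Rightarrow> 'a set" where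
  "initial X key v = {p \<in> X. card {q \<in> X. key q < key p} < v}"

lemma initial_subset: "initial X key v \<subseteq> X"
  unfolding initial_def by blast

lemma initial_mono: "v \<le> w \<Longrightarrow> initial X key v \<subseteq> initial X key w"
  unfolding initial_def by auto

lemma initial_closed:
  assumes "finite X" "p \<in> initial X key v" "q \<in> X" "key q \<le> key p"
  shows "q \<in> initial X key v"
proof -
  have "card {r \<in> X. key r < key q} \<le> card {r \<in> X. key r < key p}"
    using assms by (intro card_mono) auto
  then show ?thesis using assms unfolding initial_def by simp
qed

lemma card_initial:
  assumes fin: "finite X" and inj: "inj_on key X" and v: "v \<le> card X"
  shows "card (initial X key v) = v"
proof -
  define rank where "rank p = card {q \<in> X. key q < key p}" for p
  have lt: "rank p < rank q" if "p \<in> X" "q \<in> X" "key p < key q" for p q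
    unfolding rank_def using fin that by (intro psubset_card_mono) auto
  have injr: "inj_on rank X"
  proof (rule inj_onI)
    fix p q assume pq: "p \<in> X" "q \<in> X" "rank p = rank q"
    then have "key p = key q" using lt[of p q] lt[of q p] by (metis less_irrefl nat_neq_iff)
    then show "p = q" using inj pq by (simp add: inj_on_def)
  qed
  have "rank ` X \<subseteq> {..<card X}"
    unfolding rank_def using fin by (auto intro!: psubset_card_mono)
  then have im: "rank ` X = {..<card X}"
    using card_image[OF injr] by (intro card_subset_eq) auto
  have "rank ` initial X key v = {..<v}"
  proof -
    have "rank ` initial X key v = rank ` X \<inter> {..<v}"
      unfolding initial_def rank_def by auto
    then show ?thesis using im v by auto
  qed
  moreover have "card (rank ` initial X key v) = card (initial X key v)"
    by (rule card_image[OF inj_on_subset[OF injr initial_subset]])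
  ultimately show ?thesis by simp
qed

text \<open>
  Two sets that are closed under smaller keys are comparable by inclusion, so they are determined by
  their cardinality.
\<close>

lemma closed_eq_initial:
  assumes fin: "finite X" and inj: "inj_on key X" and D: "D \<subseteq> X"
    and closed: "\<And>p q. p \<in> D \<Longrightarrow> q \<in> X \<Longrightarrow> key q < key p \<Longrightarrow> q \<in> D"
  shows "D = initial X key (card D)"
proof -
  let ?E = "initial X key (card D)"
  have cE: "card ?E = card D"
    by (rule card_initial[OF fin inj card_mono[OF fin D]])
  have fD: "finite D" and fE: "finite ?E"
    using finite_subset[OF D fin] finite_subset[OF initial_subset fin] by auto
  have "D \<subseteq> ?E \<or> ?E \<subseteq> D"
  proof (rule ccontr)
    assume "\<not> ?thesis"
    then have "\<not> D \<subseteq> ?E" "\<not> ?E \<subseteq> D" by simp_all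
    then obtain p q where p: "p \<in> D" "p \<notin> ?E" and q: "q \<in> ?E" "q \<notin> D"
      unfolding subset_iff by metis
    have pX: "p \<in> X" using p(1) D by (rule subsetD[rotated])
    have qX: "q \<in> X" using q(1) initial_subset by (rule subsetD[rotated])
    have "\<not> key q < key p" using closed[OF p(1) qX] q(2) by blast
    then show False using initial_closed[OF fin q(1) pX] p(2) by simp
  qed
  then show ?thesis
    using card_subset_eq[OF fE _ cE[symmetric]] card_subset_eq[OF fD _ cE] by blast
qed

abbreviation grid2 :: "nat \<Rightarrow> (nat \<times> nat) set" where
  "grid2 k \<equiv> {..<k} \<times> {..<k}"

definition path2 :: "nat \<times> nat \<Rightarrow> nat \<times> nat \<Rightarrow> bool" where
  "path2 p q \<longleftrightarrow> path_rel (fst p) (fst q) \<and> snd p = snd q \<or> fst p = fst q \<and> path_rel (snd p) (snd q)"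

definition sum2 :: "nat \<times> nat \<Rightarrow> nat" where
  "sum2 p = fst p + snd p"

text \<open>
  On \<open>grid2 k\<close>, where first coordinates are below \<open>k\<close>, this number encodes the lexicographic order by
  coordinate sum and then first coordinate.
\<close>

definition key2 :: "nat \<Rightarrow> nat \<times> nat \<Rightarrow> nat" where
  "key2 k p = k * sum2 p + fst p"

lemma key2_less_iff:
  assumes "p \<in> grid2 k" "q \<in> grid2 k"
  shows "key2 k p < key2 k q \<longleftrightarrow> sum2 p < sum2 q \<or> sum2 p = sum2 q \<and> fst p < fst q"
proof -
  have *: "key2 k p < key2 k q" if "sum2 p < sum2 q" "fst p < k" for p q
  proof -
    have "k * Suc (sum2 p) \<le> k * sum2 q" using that by (intro mult_le_mono2) simp
    then show ?thesis using that unfolding key2_def by simp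
  qed
  show ?thesis
    using assms *[of p q] *[of q p] by (cases "sum2 p" "sum2 q" rule: linorder_cases) (auto simp: key2_def)
qed

lemma inj_key2: "inj_on (key2 k) (grid2 k)"
proof (rule inj_onI)
  fix p q assume pq: "p \<in> grid2 k" "q \<in> grid2 k" "key2 k p = key2 k q"
  then have "sum2 p = sum2 q \<and> fst p = fst q"
    using key2_less_iff[of p k q] key2_less_iff[of q k p] by (metis less_irrefl nat_neq_iff)
  then show "p = q" unfolding sum2_def by (auto simp: prod_eq_iff)
qed

abbreviation initial2 :: "nat \<Rightarrow> nat \<Rightarrow> (nat \<times> nat) set" where
  "initial2 k \<equiv> initial (grid2 k) (key2 k)"

lemma initial2_closed:
  assumes "p \<in> initial2 k v" "q \<in> grid2 k" "sum2 q < sum2 p \<or> sum2 q = sum2 p \<and> fst q \<le> fst p"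
  shows "q \<in> initial2 k v"
proof -
  have p: "p \<in> grid2 k" by (rule subsetD[OF initial_subset assms(1)])
  have "key2 k q \<le> key2 k p"
    using assms(3) key2_less_iff[OF assms(2) p] by (auto simp: key2_def)
  then show ?thesis by (intro initial_closed[OF _ assms(1,2)]) simp_all
qed

text \<open>
  Together with the inequality for cardinalities this makes the neighbourhood of an initial segment fit
  into the chain.
\<close>

lemma nbhd_initial2:
  "nbhd (grid2 k) path2 (initial2 k v) = initial2 k (card (nbhd (grid2 k) path2 (initial2 k v)))"
proof (rule closed_eq_initial[OF _ inj_key2 nbhd_subset])
  let ?N = "nbhd (grid2 k) path2 (initial2 k v)"
  fix p q assume "p \<in> ?N" and qG: "q \<in> grid2 k" and "key2 k q < key2 k p"
  then obtain p' where p: "p \<in> grid2 k" and p': "p' \<in> initial2 k v" "path2 p' p"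
    unfolding nbhd_def by fast
  have lt: "sum2 q < sum2 p \<or> sum2 q = sum2 p \<and> fst q < fst p"
    using key2_less_iff[OF qG p] \<open>key2 k q < key2 k p\<close> by simp
  obtain a b where ab: "p = (a, b)" by fastforce
  obtain a' b' where ab': "p' = (a', b')" by fastforce
  obtain x y where xy: "q = (x, y)" by fastforce
  have adj: "a' \<le> Suc a \<and> a \<le> Suc a' \<and> b' = b \<or> a' = a \<and> b' \<le> Suc b \<and> b \<le> Suc b'"
    using p'(2) unfolding path2_def path_rel_def ab ab' by auto
  \<comment> \<open>Stepping down from \<open>q\<close>, preferably in the first coordinate, gives a point that does not come
    after \<open>p'\<close>. At the origin truncated subtraction gives \<open>q\<close> itself.\<close>
  let ?q' = "if x > 0 then (x - 1, y) else (x, y - 1)"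
  have "?q' \<in> grid2 k" using qG xy by auto
  moreover have "sum2 ?q' < sum2 p' \<or> sum2 ?q' = sum2 p' \<and> fst ?q' \<le> fst p'"
    using lt adj unfolding ab ab' xy sum2_def by auto
  ultimately have "?q' \<in> initial2 k v" by (rule initial2_closed[OF p'(1)])
  moreover have "path2 ?q' q" unfolding path2_def path_rel_def xy by auto
  ultimately show "q \<in> ?N" using qG unfolding nbhd_def by fast
qed simp

section \<open>Sorting sets in the square grid by coordinate sum\<close>

lemma compression_fst: "compression (grid2 k) path2 {..<k} path_rel path_rel fst snd (\<lambda>v. {..<min v k})"
proof
  show "bij_betw (\<lambda>x. (fst x, snd x)) (grid2 k) ({..<k} \<times> snd ` grid2 k)"
    by (cases "k = 0") (auto simp: bij_betw_def)
qed (auto simp: path2_def iso_chain_path)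

lemma compression_snd: "compression (grid2 k) path2 {..<k} path_rel path_rel snd fst (\<lambda>v. {..<min v k})"
proof
  show "bij_betw (\<lambda>x. (snd x, fst x)) (grid2 k) ({..<k} \<times> fst ` grid2 k)"
    by (cases "k = 0") (auto simp: bij_betw_def inj_on_def image_iff)
qed (auto simp: path2_def iso_chain_path)

definition down_set2 :: "(nat \<times> nat) set \<Rightarrow> bool" where
  "down_set2 S \<longleftrightarrow> (\<forall>a b a' b'. (a, b) \<in> S \<longrightarrow> a' \<le> a \<longrightarrow> b' \<le> b \<longrightarrow> (a', b') \<in> S)"

lemma non_down_set_improvable:
  assumes S: "S \<subseteq> grid2 k" and "\<not> down_set2 S"
  shows "\<exists>S'\<subseteq>grid2 k. card S' = card S \<and> sum sum2 S' < sum sum2 S \<and>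
           card (nbhd (grid2 k) path2 S') \<le> card (nbhd (grid2 k) path2 S)"
proof -
  obtain a b a' b' where ab: "(a, b) \<in> S" "a' \<le> a" "b' \<le> b" "(a', b') \<notin> S"
    using assms(2) unfolding down_set2_def by blast
  have G: "a < k" "b < k" using ab S by auto
  have "\<exists>S'\<subseteq>grid2 k. card S' = card S \<and> sum sum2 S' < sum sum2 S \<and>
          (\<forall>t. card ((nbhd (grid2 k) path2 ^^ t) S') \<le> card ((nbhd (grid2 k) path2 ^^ t) S))"
  proof (cases "(a', b) \<in> S")
    case True
    then have "b' < b" using ab by (metis le_neq_implies_less)
    then show ?thesis
      by (intro compression.improve[OF compression_snd _ S True, where y = "(a', b')"])
        (use ab G in \<open>auto simp: sum2_def\<close>)
  next
    case False
    then have "a' < a" using ab by (metis le_neq_implies_less)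
    then show ?thesis
      by (intro compression.improve[OF compression_fst _ S ab(1), where y = "(a', b)"])
        (use False ab G in \<open>auto simp: sum2_def\<close>)
  qed
  then obtain S' where "S' \<subseteq> grid2 k" "card S' = card S" "sum sum2 S' < sum sum2 S"
    and le: "\<And>t. card ((nbhd (grid2 k) path2 ^^ t) S') \<le> card ((nbhd (grid2 k) path2 ^^ t) S)"
    by metis
  then show ?thesis using le[of 1] by (intro exI[of _ S']) simp
qed

lemma change_step:
  fixes f :: "nat \<Rightarrow> bool"
  assumes "m \<le> n" "f m \<noteq> f n"
  shows "\<exists>x\<ge>m. x < n \<and> f x \<noteq> f (Suc x)"
  using assms
proof (induction n rule: dec_induct)
  case (step n)
  then show ?case by (cases "f n = f m") (auto intro: less_SucI)
qed simp

text \<open>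
  Walking along an antidiagonal from a point inside \<open>S\<close> to a point outside, two consecutive points
  \<open>(Suc a, b)\<close> and \<open>(a, Suc b)\<close> must differ in membership. They share the upper neighbour
  \<open>(Suc a, Suc b)\<close> and the lower neighbour \<open>(a, b)\<close>.
\<close>

lemma level_boundary:
  assumes "u \<in> S" "u \<in> grid2 k" "v \<in> grid2 k - S" "sum2 u = r" "sum2 v = r"
  shows "\<exists>a b. (Suc a, Suc b) \<in> grid2 k \<and> Suc (a + b) = r \<and> ((Suc a, b) \<in> S \<longleftrightarrow> (a, Suc b) \<notin> S)"
proof -
  let ?f = "\<lambda>x. (x, r - x) \<in> S"
  have uv: "u = (fst u, r - fst u)" "v = (fst v, r - fst v)" "fst u \<le> r" "fst v \<le> r"
    using assms(4,5) unfolding sum2_def by (auto simp: prod_eq_iff)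
  have ne: "?f (fst u)" "\<not> ?f (fst v)" using assms uv by auto
  define m where "m = min (fst u) (fst v)"
  define n where "n = max (fst u) (fst v)"
  have "m \<le> n" "?f m \<noteq> ?f n" using ne unfolding m_def n_def by (auto simp: min_def max_def)
  then obtain x where x: "m \<le> x" "x < n" "?f x \<noteq> ?f (Suc x)"
    using change_step[of m n ?f] by blast
  have n: "n < k" "n \<le> r" and m: "r - m < k"
    using assms uv unfolding n_def m_def by (auto simp: min_def max_def)
  have "Suc (r - Suc x) = r - x" using x n by simp
  then show ?thesis
    using x n m by (intro exI[of _ x] exI[of _ "r - Suc x"]) auto
qed

lemma nbhdI: "y \<in> A \<Longrightarrow> R y x \<Longrightarrow> x \<in> X \<Longrightarrow> x \<in> nbhd X R A"
  unfolding nbhd_def by blast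

lemma path2_steps:
  "path2 p p" "path2 (a, b) (Suc a, b)" "path2 (a, b) (a, Suc b)"
  by (simp_all add: path2_def path_rel_def)

lemma corner_in_nbhd:
  assumes "(Suc a, Suc b) \<in> X" "(Suc a, b) \<in> S \<or> (a, Suc b) \<in> S"
  shows "(Suc a, Suc b) \<in> nbhd X path2 S"
  using assms(2)
proof
  assume "(Suc a, b) \<in> S"
  then show ?thesis by (rule nbhdI) (simp_all add: path2_steps assms(1))
next
  assume "(a, Suc b) \<in> S"
  then show ?thesis by (rule nbhdI) (simp_all add: path2_steps assms(1))
qed

text \<open>
  Let \<open>s\<close> be the top level of \<open>S\<close> and \<open>r < s\<close> the lowest level that is not full. On level \<open>s\<close> some
  member \<open>u\<close> is next to a nonmember on the antidiagonal; removing \<open>u\<close> makes the common upper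
  neighbour of the two leave the neighbourhood, because no other point of \<open>S\<close> is adjacent to it. On level \<open>r\<close>
  some nonmember \<open>w\<close> is next to a member; adding \<open>w\<close> contributes at most its other upper
  neighbour \<open>g\<close>, since the common one is already present and all lower levels are full. The exchange thus does not enlarge
  the neighbourhood, and it lowers the coordinate sum by \<open>s - r\<close>.
\<close>

lemma unsorted_improvable:
  assumes S: "S \<subseteq> grid2 k" and ds: "down_set2 S"
    and p: "p \<in> S" and q: "q \<in> grid2 k - S" and lt: "sum2 q < sum2 p"
  shows "\<exists>S'\<subseteq>grid2 k. card S' = card S \<and> sum sum2 S' < sum sum2 S \<and>
           card (nbhd (grid2 k) path2 S') \<le> card (nbhd (grid2 k) path2 S)"
proof -
  let ?N = "nbhd (grid2 k) path2"
  have finS: "finite S" using finite_subset[OF S] by simp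
  define s where "s = Max (sum2 ` S)"
  have le_s: "sum2 z \<le> s" if "z \<in> S" for z using that finS unfolding s_def by simp
  have "s \<in> sum2 ` S" unfolding s_def using p finS by (intro Max_in) auto
  then obtain u0 where u0: "u0 \<in> S" "sum2 u0 = s" by auto
  define r where "r = (LEAST n. \<exists>z\<in>grid2 k - S. sum2 z = n)"
  have "\<exists>z\<in>grid2 k - S. sum2 z = r"
    unfolding r_def by (rule LeastI[of _ "sum2 q"]) (use q in blast)
  then obtain v0 where v0: "v0 \<in> grid2 k - S" "sum2 v0 = r" by blast
  have below_r: "z \<in> S" if "z \<in> grid2 k" "sum2 z < r" for z
    using that not_less_Least[of "sum2 z" "\<lambda>n. \<exists>z\<in>grid2 k - S. sum2 z = n"] unfolding r_def by blast
  have "r \<le> sum2 q" unfolding r_def by (rule Least_le) (use q in blast)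
  then have rs: "r < s" using lt le_s[OF p] by simp
  have lower: "\<exists>z\<in>S. sum2 z = n" if "n \<le> s" for n
  proof -
    obtain a b where ab: "u0 = (a, b)" by fastforce
    have "(min a n, n - min a n) \<in> S"
      using ds u0 that unfolding down_set2_def ab sum2_def by auto
    then show ?thesis unfolding sum2_def by (intro bexI[of _ "(min a n, n - min a n)"]) auto
  qed
  \<comment> \<open>A full level \<open>s\<close> of a down-set would fill all levels below it: above \<open>v0\<close> there is a grid point
    of level \<open>s\<close>.\<close>
  have nonfull: "\<exists>z\<in>grid2 k - S. sum2 z = s"
  proof -
    obtain a b where ab: "v0 = (a, b)" by fastforce
    obtain c d where cd: "u0 = (c, d)" by fastforce
    have G: "a < k" "b < k" "c < k" "d < k" using v0 u0 S ab cd by auto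
    have sums: "a + b = r" "c + d = s" using u0 v0 ab cd unfolding sum2_def by auto
    define x where "x = min (k - 1) (s - b)"
    have xs: "a \<le> x" "x < k" "b \<le> s - x" "s - x < k" "x \<le> s"
      using G sums rs unfolding x_def by auto
    have "(x, s - x) \<notin> S" using ds xs v0 ab unfolding down_set2_def by blast
    then show ?thesis using xs by (intro bexI[of _ "(x, s - x)"]) (auto simp: sum2_def)
  qed
  obtain u1 where u1: "u1 \<in> grid2 k - S" "sum2 u1 = s" using nonfull by blast
  obtain a b where ab: "(Suc a, Suc b) \<in> grid2 k" "Suc (a + b) = s" "(Suc a, b) \<in> S \<longleftrightarrow> (a, Suc b) \<notin> S"
    using level_boundary[OF u0(1) _ u1(1) u0(2) u1(2)] u0 S by blast
  obtain v1 where v1: "v1 \<in> S" "sum2 v1 = r" using lower[of r] rs by auto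
  obtain c d where cd: "(Suc c, Suc d) \<in> grid2 k" "Suc (c + d) = r" "(Suc c, d) \<in> S \<longleftrightarrow> (c, Suc d) \<notin> S"
    using level_boundary[OF v1(1) _ v0(1) v1(2) v0(2)] v1 S by blast
  define u where "u = (if (Suc a, b) \<in> S then (Suc a, b) else (a, Suc b))"
  define w where "w = (if (Suc c, d) \<in> S then (c, Suc d) else (Suc c, d))"
  define g where "g = (if (Suc c, d) \<in> S then (c, Suc (Suc d)) else (Suc (Suc c), d))"
  have u: "u \<in> S" "sum2 u = s" using ab unfolding u_def sum2_def by auto
  have w: "w \<in> grid2 k - S" "sum2 w = r" using cd unfolding w_def sum2_def by auto
  define S' where "S' = insert w (S - {u})"
  have S': "S' \<subseteq> grid2 k" unfolding S'_def using S w by auto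
  have cardS': "card S' = card S"
    unfolding S'_def using finS u w card_Suc_Diff1[OF finS u(1)] by simp
  have sumS': "sum sum2 S' < sum sum2 S"
    unfolding S'_def using finS u w rs sum.remove[OF finS u(1), of sum2] by simp
  have sup: "(Suc a, Suc b) \<in> ?N S"
    using ab by (intro corner_in_nbhd) auto
  have "?N S' \<subseteq> insert g (?N S - {(Suc a, Suc b)})"
  proof
    fix z assume "z \<in> ?N S'"
    then obtain y where z: "z \<in> grid2 k" and y: "y \<in> S'" "path2 y z"
      unfolding nbhd_def by fast
    show "z \<in> insert g (?N S - {(Suc a, Suc b)})"
    proof (cases "y = w")
      case False
      then have yS: "y \<in> S" "y \<noteq> u" using y unfolding S'_def by auto
      have "z \<in> ?N S" using z y(2) yS(1) unfolding nbhd_def by fast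
      moreover have "z \<noteq> (Suc a, Suc b)"
      proof
        assume zeq: "z = (Suc a, Suc b)"
        obtain y1 y2 where yy: "y = (y1, y2)" by fastforce
        have "y1 + y2 \<le> Suc (a + b)" using le_s[OF yS(1)] ab(2) unfolding yy sum2_def by simp
        then have "y = (Suc a, b) \<or> y = (a, Suc b)"
          using y(2) unfolding zeq yy path2_def path_rel_def by auto
        then show False using yS ab(3) unfolding u_def by (auto split: if_splits)
      qed
      ultimately show ?thesis by simp
    next
      case True
      obtain z1 z2 where zz: "z = (z1, z2)" by fastforce
      have "sum2 z \<le> Suc r" using y(2) w(2) unfolding True path2_def path_rel_def sum2_def by auto
      then have zne: "z \<noteq> (Suc a, Suc b)" using rs ab(2) unfolding sum2_def by auto
      \<comment> \<open>The points adjacent to \<open>w\<close>: itself, its lower neighbours, \<open>g\<close>, and the upper neighbour shared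
        with the member of \<open>S\<close> next to \<open>w\<close>.\<close>
      have corner: "(c, d) \<in> S" using below_r[of "(c, d)"] cd unfolding sum2_def by auto
      have "sum2 z < r \<or> z = w \<or> z = g \<or> z = (Suc c, Suc d)"
        using y(2) cd(2) unfolding True w_def g_def zz path2_def path_rel_def sum2_def
        by (auto split: if_splits)
      then consider "sum2 z < r" | "z = w" | "z = g" | "z = (Suc c, Suc d)" by blast
      then show ?thesis
      proof cases
        case 1
        then have "z \<in> ?N S" by (intro nbhdI[where y = z] below_r path2_steps(1) z)
        then show ?thesis using zne by simp
      next
        case 2
        have "path2 (c, d) w" unfolding w_def by (simp add: path2_steps)
        then have "z \<in> ?N S" using 2 z by (intro nbhdI[where y = "(c, d)"] corner) simp_all
        then show ?thesis using zne by simp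
      next
        case 4
        have "z \<in> ?N S" using cd unfolding 4 by (intro corner_in_nbhd) auto
        then show ?thesis using zne by simp
      qed simp
    qed
  qed
  then have "card (?N S') \<le> card (insert g (?N S - {(Suc a, Suc b)}))"
    by (rule card_mono[rotated]) (simp add: finite_subset[OF nbhd_subset])
  also have "\<dots> \<le> Suc (card (?N S - {(Suc a, Suc b)}))"
    by (rule card_insert_le_m1) simp_all
  also have "\<dots> = card (?N S)"
    by (rule card_Suc_Diff1[OF _ sup]) (simp add: finite_subset[OF nbhd_subset])
  finally show ?thesis using S' cardS' sumS' by blast
qed

section \<open>The vertex-isoperimetric inequality in the square grid\<close>

text \<open>
  Both \<open>S\<close> and the initial segment \<open>J\<close> of the same size contain all levels below \<open>r\<close> and nothing above
  level \<open>r\<close>, so only the upper shadows of their level-\<open>r\<close> parts, each of size \<open>p\<close>, have to be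
  compared. For \<open>Suc r < k\<close> the shadow of \<open>J\<close> on level \<open>Suc r\<close> has \<open>p + 1\<close> points, and any \<open>p > 0\<close> points
  on an antidiagonal have at least that many upper neighbours. For \<open>Suc r \<ge> k\<close> the next level is shorter,
  both of its end points being cut off: the shadow of \<open>J\<close> has only \<open>p\<close> points, and a
  set that misses a point of the level has at least \<open>p\<close> upper neighbours.
\<close>

lemma card_nbhd_initial2_le:
  assumes S: "S \<subseteq> grid2 k"
    and sorted: "\<And>p q. p \<in> S \<Longrightarrow> q \<in> grid2 k - S \<Longrightarrow> sum2 p \<le> sum2 q"
  shows "card (nbhd (grid2 k) path2 (initial2 k (card S))) \<le> card (nbhd (grid2 k) path2 S)"
proof (cases "S = {}")
  case True
  then show ?thesis unfolding nbhd_def initial_def by simp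
next
  case ne: False
  let ?N = "nbhd (grid2 k) path2"
  define J where "J = initial2 k (card S)"
  have J: "J \<subseteq> grid2 k" unfolding J_def by (rule initial_subset)
  have finS: "finite S" and finJ: "finite J"
    using finite_subset[OF S] finite_subset[OF J] by simp_all
  have cJ: "card J = card S"
    unfolding J_def by (rule card_initial[OF _ inj_key2 card_mono[OF _ S]]) simp_all
  have Jcl: "z \<in> J" if "y \<in> J" "z \<in> grid2 k" "sum2 z < sum2 y \<or> sum2 z = sum2 y \<and> fst z \<le> fst y" for y z
    using that unfolding J_def by (rule initial2_closed)
  define r where "r = Max (sum2 ` S)"
  have upS: "sum2 z \<le> r" if "z \<in> S" for z using that finS unfolding r_def by simp
  have "r \<in> sum2 ` S" unfolding r_def using ne finS by (intro Max_in) auto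
  then obtain t where t: "t \<in> S" "sum2 t = r" by auto
  have lowS: "z \<in> S" if "z \<in> grid2 k" "sum2 z < r" for z
    using sorted[OF t(1), of z] t(2) that by (cases "z \<in> S") auto
  have upJ: "sum2 z \<le> r" if "z \<in> J" for z
  proof (rule ccontr)
    assume gt: "\<not> sum2 z \<le> r"
    have "S \<subseteq> J"
    proof
      fix y assume "y \<in> S"
      then show "y \<in> J" using Jcl[OF that, of y] upS[of y] gt S by auto
    qed
    then have "S = J" using card_subset_eq[OF finJ _ cJ[symmetric]] by blast
    then show False using upS that gt by blast
  qed
  have lowJ: "z \<in> J" if z: "z \<in> grid2 k" "sum2 z < r" for z
  proof (rule ccontr)
    assume nz: "z \<notin> J"
    have "J \<subseteq> S"
    proof
      fix y assume y: "y \<in> J"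
      then have "\<not> sum2 z < sum2 y" using Jcl[OF y z(1)] nz by blast
      then show "y \<in> S" using lowS[of y] z y J by auto
    qed
    then have "J = S" using card_subset_eq[OF finS _ cJ] by blast
    then show False using lowS z nz by blast
  qed
  let ?B = "{z \<in> grid2 k. sum2 z < r}" and ?L = "{z \<in> grid2 k. sum2 z \<le> r}"
  let ?l = "\<lambda>D. {z \<in> D. sum2 z = r}" and ?u = "\<lambda>D. {z \<in> ?N D. sum2 z = Suc r}"
  have split: "D = ?B \<union> ?l D"
    if "D \<subseteq> grid2 k" "\<And>z. z \<in> D \<Longrightarrow> sum2 z \<le> r" "\<And>z. z \<in> grid2 k \<Longrightarrow> sum2 z < r \<Longrightarrow> z \<in> D" for D
  proof (intro equalityI subsetI)
    fix z assume z: "z \<in> D"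
    then have "z \<in> grid2 k" "sum2 z \<le> r" using that by blast+
    then show "z \<in> ?B \<union> ?l D" using z by (cases "sum2 z = r") auto
  qed (use that in blast)
  note splitS = split[OF S upS lowS] and splitJ = split[OF J upJ lowJ]
  have cardU: "card (?B \<union> ?l D) = card ?B + card (?l D)" if "finite D" for D
    by (rule card_Un_disjoint) (use that in auto)
  have cS: "card S = card ?B + card (?l S)"
    using arg_cong[OF splitS, of card] unfolding cardU[OF finS] .
  have cJ': "card J = card ?B + card (?l J)"
    using arg_cong[OF splitJ, of card] unfolding cardU[OF finJ] .
  have cl: "card (?l J) = card (?l S)" using cS cJ' cJ by simp
  define p where "p = card (?l S)"
  \<comment> \<open>The smallest first coordinate on level \<open>r\<close>; truncated subtraction gives 0 when \<open>Suc r \<le> k\<close>.\<close>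
  define lo where "lo = Suc r - k"
  have finN: "finite (?N D)" for D by (rule finite_subset[OF nbhd_subset]) simp
  have "card ?L + card (?u S) \<le> card (?N S)"
  proof -
    have "?L \<subseteq> ?N S"
    proof
      fix z assume z: "z \<in> ?L"
      obtain a b where ab: "z = (a, b)" by fastforce
      show "z \<in> ?N S"
      proof (cases "sum2 z < r \<or> z \<in> S")
        case True
        then have "z \<in> S" using lowS z by blast
        then show ?thesis using z by (intro nbhdI[where y = z] path2_steps(1)) auto
      next
        case False
        then have zr: "sum2 z = r" "z \<notin> S" using z by auto
        have "r > 0"
        proof (rule ccontr)
          assume "\<not> r > 0"
          then have "t = z" using t zr unfolding sum2_def by (simp add: prod_eq_iff)
          then show False using t zr by simp
        qed
        let ?z' = "if a > 0 then (a - 1, b) else (a, b - 1)"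
        have "?z' \<in> S" using z zr \<open>r > 0\<close> unfolding ab by (intro lowS) (auto simp: sum2_def)
        moreover have "path2 ?z' z" unfolding ab path2_def path_rel_def by auto
        ultimately show ?thesis using z by (intro nbhdI[where y = ?z']) auto
      qed
    qed
    then have "card (?L \<union> ?u S) \<le> card (?N S)" using finN by (intro card_mono) auto
    moreover have "card (?L \<union> ?u S) = card ?L + card (?u S)"
      using finN by (intro card_Un_disjoint) auto
    ultimately show ?thesis by simp
  qed
  moreover have "card (?N J) \<le> card ?L + card (?u J)"
  proof -
    have "?N J \<subseteq> ?L \<union> ?u J"
    proof
      fix z assume z: "z \<in> ?N J"
      then obtain y where "y \<in> J" "path2 y z" "z \<in> grid2 k" unfolding nbhd_def by fast
      then have "sum2 z \<le> Suc r" using upJ[of y] unfolding path2_def path_rel_def sum2_def by auto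
      then show "z \<in> ?L \<union> ?u J" using z \<open>z \<in> grid2 k\<close> by auto
    qed
    then have "card (?N J) \<le> card (?L \<union> ?u J)" using finN by (intro card_mono) auto
    also have "\<dots> \<le> card ?L + card (?u J)" by (rule card_Un_le)
    finally show ?thesis .
  qed
  moreover have "card (?N J) \<le> card (?N S) \<or> card (?u J) \<le> card (?u S)"
  proof -
    have injfst: "inj_on fst (?u J)" by (auto simp: inj_on_def sum2_def)
    have range: "Suc (Suc r) - k \<le> fst z \<and> fst z \<le> lo + p" if zu: "z \<in> ?u J" for z
    proof -
      obtain a b where ab: "z = (a, b)" by fastforce
      obtain y where y: "y \<in> J" "path2 y z" and z: "z \<in> grid2 k" "sum2 z = Suc r"
        using zu unfolding nbhd_def by fast
      have yr: "sum2 y = r" and ya: "a \<le> Suc (fst y)"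
        using y(2) upJ[OF y(1)] z(2) unfolding path2_def path_rel_def sum2_def ab by auto
      have yk: "snd y < k" "fst y < k" using y(1) J by auto
      \<comment> \<open>\<open>J\<close> takes its level-\<open>r\<close> points from the left, hence \<open>fst y < lo + p\<close>.\<close>
      have "{lo..fst y} \<subseteq> fst ` ?l J"
      proof
        fix x assume x: "x \<in> {lo..fst y}"
        then have "(x, r - x) \<in> J"
          using yk yr unfolding lo_def by (intro Jcl[OF y(1)]) (auto simp: sum2_def)
        then have "(x, r - x) \<in> ?l J" using x yr by (auto simp: sum2_def)
        then show "x \<in> fst ` ?l J" by force
      qed
      then have "card {lo..fst y} \<le> card (fst ` ?l J)" using finJ by (intro card_mono) auto
      also have "\<dots> \<le> p" unfolding p_def cl[symmetric] using finJ by (intro card_image_le) auto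
      finally have "Suc (fst y) \<le> lo + p" using yk yr unfolding lo_def sum2_def by simp
      then show ?thesis using ya z unfolding ab sum2_def by auto
    qed
    have cu: "card (?u J) \<le> card {Suc (Suc r) - k..lo + p}"
      unfolding card_image[OF injfst, symmetric] using range by (intro card_mono) auto
    show ?thesis
    proof (cases "Suc r < k")
      case True
      \<comment> \<open>Moving the level up in the second coordinate gives \<open>p\<close> points of the shadow, and moving
        its rightmost point to the right gives one more.\<close>
      have fl: "finite (?l S)" using finS by simp
      define a where "a = Max (fst ` ?l S)"
      have "a \<in> fst ` ?l S" unfolding a_def by (intro Max_in) (use t fl in blast)+
      then obtain b where ab: "(a, b) \<in> S" "a + b = r" unfolding sum2_def by auto
      let ?f = "\<lambda>z::nat \<times> nat. (fst z, Suc (snd z))"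
      have new: "(Suc a, b) \<notin> ?f ` ?l S"
      proof
        assume "(Suc a, b) \<in> ?f ` ?l S"
        then have "Suc a \<in> fst ` ?l S" by force
        then have "Suc a \<le> a" unfolding a_def using fl by (intro Max_ge) auto
        then show False by simp
      qed
      have "insert (Suc a, b) (?f ` ?l S) \<subseteq> ?u S"
      proof (intro insert_subsetI subsetI)
        show "(Suc a, b) \<in> ?u S"
          using ab True by (auto simp: sum2_def intro!: nbhdI[OF ab(1)] path2_steps)
        fix z assume "z \<in> ?f ` ?l S"
        then obtain x y where "(x, y) \<in> S" "x + y = r" "z = (x, Suc y)" unfolding sum2_def by auto
        then show "z \<in> ?u S"
          using True by (auto simp: sum2_def intro!: nbhdI[of "(x, y)"] path2_steps)
      qed
      then have "card (insert (Suc a, b) (?f ` ?l S)) \<le> card (?u S)"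
        using finN by (intro card_mono) auto
      moreover have "card (insert (Suc a, b) (?f ` ?l S)) = Suc p"
        using new fl unfolding p_def by (simp add: card_image inj_on_def prod_eq_iff)
      ultimately show ?thesis using cu True unfolding lo_def by simp
    next
      case False
      show ?thesis
      proof (cases "?L \<subseteq> S")
        case True
        have "J \<subseteq> S" using True upJ J by auto
        then have "J = S" using card_subset_eq[OF finS _ cJ] by blast
        then show ?thesis by simp
      next
        case nfull: False
        then obtain q where q: "q \<in> grid2 k" "sum2 q \<le> r" "q \<notin> S" by blast
        then have qr: "sum2 q = r" using lowS[of q] by (meson le_neq_implies_less)
        \<comment> \<open>A missing point \<open>q\<close> of level \<open>r\<close> separates the level. Moving the points left of \<open>q\<close> to the right
          and those right of \<open>q\<close> upwards is injective and never leaves the grid.\<close>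
        define g where "g = fst q"
        let ?f = "\<lambda>z::nat \<times> nat. if fst z < g then (Suc (fst z), snd z) else (fst z, Suc (snd z))"
        have ng: "fst z \<noteq> g" if "z \<in> ?l S" for z
        proof
          assume "fst z = g"
          then have "z = q" using that qr unfolding g_def sum2_def by (auto simp: prod_eq_iff)
          then show False using that q by simp
        qed
        have sub: "?f ` ?l S \<subseteq> ?u S"
        proof
          fix w assume "w \<in> ?f ` ?l S"
          then obtain z where z: "z \<in> ?l S" "w = ?f z" by blast
          obtain x y where xy: "z = (x, y)" by fastforce
          have "w \<in> grid2 k"
            using z ng[OF z(1)] q(1) qr S unfolding xy g_def sum2_def by (auto split: if_splits)
          moreover have "path2 z w" using z(2) unfolding xy by (simp add: path2_steps)
          ultimately have "w \<in> ?N S" using z(1) by (intro nbhdI[where y = z]) auto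
          then show "w \<in> ?u S" using z unfolding sum2_def by auto
        qed
        have inj: "inj_on ?f (?l S)"
        proof (rule inj_onI)
          fix y z assume yz: "y \<in> ?l S" "z \<in> ?l S" "?f y = ?f z"
          then show "y = z" using ng[OF yz(1)] ng[OF yz(2)] by (auto simp: prod_eq_iff split: if_splits)
        qed
        have "p \<le> card (?u S)"
          unfolding p_def by (rule card_inj_on_le[OF inj sub]) (simp add: finN)
        moreover have "card (?u J) \<le> p" using cu False unfolding lo_def by simp
        ultimately show ?thesis by simp
      qed
    qed
  qed
  ultimately have "card (?N J) \<le> card (?N S)" by linarith
  then show ?thesis unfolding J_def .
qed

theorem iso_chain_grid2: "iso_chain (grid2 k) path2 (initial2 k)"
proof -
  let ?N = "nbhd (grid2 k) path2"
  have "?N (initial2 k (card S)) \<subseteq> initial2 k (card (?N S))" if S: "S \<subseteq> grid2 k" for S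
  proof -
    let ?Q = "\<lambda>T. T \<subseteq> grid2 k \<and> card T = card S \<and> card (?N T) \<le> card (?N S)"
    obtain T where T: "?Q T" and min: "\<And>T'. ?Q T' \<Longrightarrow> sum sum2 T \<le> sum sum2 T'"
      using ex_has_least_nat[of ?Q S "sum sum2"] S by auto
    have stuck: "\<not> (\<exists>T'\<subseteq>grid2 k. card T' = card T \<and> sum sum2 T' < sum sum2 T \<and> card (?N T') \<le> card (?N T))"
    proof
      assume "\<exists>T'\<subseteq>grid2 k. card T' = card T \<and> sum sum2 T' < sum sum2 T \<and> card (?N T') \<le> card (?N T)"
      then obtain T' where "T' \<subseteq> grid2 k" "card T' = card T" "sum sum2 T' < sum sum2 T" "card (?N T') \<le> card (?N T)"
        by blast
      then show False using min[of T'] T by simp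
    qed
    have "down_set2 T" using non_down_set_improvable[of T k] T stuck by blast
    then have "sum2 p \<le> sum2 q" if "p \<in> T" "q \<in> grid2 k - T" for p q
      using unsorted_improvable[of T k p q] T stuck that not_less by blast
    then have "card (?N (initial2 k (card T))) \<le> card (?N T)"
      using T by (intro card_nbhd_initial2_le) auto
    then have "card (?N (initial2 k (card S))) \<le> card (?N S)" using T by simp
    then show ?thesis by (subst nbhd_initial2) (rule initial_mono)
  qed
  then show ?thesis
    unfolding iso_chain_def
    by (auto simp: initial_subset card_initial inj_key2 intro!: monoI initial_mono)
qed

section \<open>The grid of arbitrary dimension\<close>

definition grid :: "nat \<Rightarrow> ('n \<Rightarrow> nat) set" where
  "grid k = {x. \<forall>i. x i < k}"

definition grid_adj :: "('n \<Rightarrow> nat) \<Rightarrow> ('n \<Rightarrow> nat) \<Rightarrow> bool" where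
  "grid_adj x y \<longleftrightarrow> (\<exists>i. (\<forall>l. l \<noteq> i \<longrightarrow> x l = y l) \<and> path_rel (x i) (y i))"

definition coord_sum :: "('n \<Rightarrow> nat) \<Rightarrow> nat" where
  "coord_sum x = (\<Sum>i\<in>UNIV. x i)"

lemma grid_adj_refl [simp]: "grid_adj x x"
  unfolding grid_adj_def by simp

lemma finite_grid: "finite (grid k :: ('n::finite \<Rightarrow> nat) set)"
proof -
  have "grid k = (PiE UNIV (\<lambda>_. {..<k}) :: ('n \<Rightarrow> nat) set)"
    unfolding grid_def by (auto simp: PiE_def)
  then show ?thesis by (simp add: finite_PiE)
qed

lemma coord_sum_upd: "coord_sum (x(i := a)) + x i = coord_sum x + a" for x :: "'n::finite \<Rightarrow> nat"
proof -
  have "coord_sum (x(i := a)) = a + (\<Sum>l\<in>UNIV - {i}. x l)" "coord_sum x = x i + (\<Sum>l\<in>UNIV - {i}. x l)"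
    unfolding coord_sum_def by (subst sum.remove[of _ i]; simp)+
  then show ?thesis by simp
qed

lemma coord_sum_zero1: "coord_sum x = coord_sum (x(i := 0)) + x i" for x :: "'n::finite \<Rightarrow> nat"
  using coord_sum_upd[of x i 0] by simp

lemma coord_sum_zero2:
  "i \<noteq> j \<Longrightarrow> coord_sum x = coord_sum (x(i := 0, j := 0)) + (x i + x j)" for x :: "'n::finite \<Rightarrow> nat"
  using coord_sum_upd[of x i 0] coord_sum_upd[of "x(i := 0)" j 0] by simp

lemma compression_coord:
  "compression (grid k :: ('n::finite \<Rightarrow> nat) set) grid_adj {..<k} path_rel grid_adj
     (\<lambda>x. x i) (\<lambda>x. x(i := 0)) (\<lambda>v. {..<min v k})"
proof
  show "finite (grid k :: ('n \<Rightarrow> nat) set)" by (rule finite_grid)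
  show "iso_chain {..<k} path_rel (\<lambda>v. {..<min v k})" by (rule iso_chain_path)
  let ?\<pi> = "\<lambda>x::'n \<Rightarrow> nat. x(i := 0)"
  have eqI: "x = y" if "?\<pi> x = ?\<pi> y" "x i = y i" for x y
    using that by (metis fun_upd_triv fun_upd_upd)
  show "bij_betw (\<lambda>x. (x i, ?\<pi> x)) (grid k) ({..<k} \<times> ?\<pi> ` grid k)"
    unfolding bij_betw_def
  proof (intro conjI equalityI subsetI)
    show "inj_on (\<lambda>x. (x i, ?\<pi> x)) (grid k)" using eqI by (auto simp: inj_on_def)
    fix p assume "p \<in> {..<k} \<times> ?\<pi> ` grid k"
    then obtain a x where p: "p = (a, ?\<pi> x)" "a < k" "x \<in> grid k" by auto
    then have "x(i := a) \<in> grid k" unfolding grid_def by simp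
    then show "p \<in> (\<lambda>x. (x i, ?\<pi> x)) ` grid k" using p by (intro image_eqI[of _ _ "x(i := a)"]) auto
  qed (auto simp: grid_def)
  fix x y :: "'n \<Rightarrow> nat"
  show "grid_adj x y \<longleftrightarrow> path_rel (x i) (y i) \<and> ?\<pi> x = ?\<pi> y \<or> x i = y i \<and> grid_adj (?\<pi> x) (?\<pi> y)"
    (is "?L \<longleftrightarrow> ?R")
  proof
    assume ?L
    then obtain m where m: "\<And>l. l \<noteq> m \<Longrightarrow> x l = y l" "path_rel (x m) (y m)"
      unfolding grid_adj_def by blast
    show ?R
    proof (cases "m = i")
      case True
      then show ?thesis using m by (auto simp: fun_eq_iff)
    next
      case False
      then have "grid_adj (?\<pi> x) (?\<pi> y)" unfolding grid_adj_def using m by (intro exI[of _ m]) simp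
      then show ?thesis using m(1)[of i] False by simp
    qed
  next
    assume ?R
    then show ?L
    proof (elim disjE conjE)
      assume "path_rel (x i) (y i)" "?\<pi> x = ?\<pi> y"
      then show ?L unfolding grid_adj_def by (intro exI[of _ i]) (metis fun_upd_other)
    next
      assume xy: "x i = y i" and "grid_adj (?\<pi> x) (?\<pi> y)"
      then obtain m where m: "\<And>l. l \<noteq> m \<Longrightarrow> ?\<pi> x l = ?\<pi> y l" "path_rel (?\<pi> x m) (?\<pi> y m)"
        unfolding grid_adj_def by blast
      have "x l = y l" if "l \<noteq> m" for l using m(1)[OF that] xy by (simp split: if_splits)
      moreover have "path_rel (x m) (y m)" using m(2) xy by (simp split: if_splits)
      ultimately show ?L unfolding grid_adj_def by blast
    qed
  qed
qed

lemma compression_pair: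
  assumes ij: "i \<noteq> j"
  shows "compression (grid k :: ('n::finite \<Rightarrow> nat) set) grid_adj (grid2 k) path2 grid_adj
     (\<lambda>x. (x i, x j)) (\<lambda>x. x(i := 0, j := 0)) (initial2 k)"
proof
  show "finite (grid k :: ('n \<Rightarrow> nat) set)" by (rule finite_grid)
  show "iso_chain (grid2 k) path2 (initial2 k)" by (rule iso_chain_grid2)
  let ?\<pi> = "\<lambda>x::'n \<Rightarrow> nat. x(i := 0, j := 0)"
  have \<pi>_eq: "?\<pi> x = ?\<pi> y \<longleftrightarrow> (\<forall>l. l \<noteq> i \<longrightarrow> l \<noteq> j \<longrightarrow> x l = y l)" for x y
    by (auto simp: fun_eq_iff)
  show "bij_betw (\<lambda>x. ((x i, x j), ?\<pi> x)) (grid k) (grid2 k \<times> ?\<pi> ` grid k)"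
    unfolding bij_betw_def
  proof (intro conjI equalityI subsetI)
    show "inj_on (\<lambda>x. ((x i, x j), ?\<pi> x)) (grid k)"
    proof (rule inj_onI)
      fix x y assume "((x i, x j), ?\<pi> x) = ((y i, y j), ?\<pi> y)"
      then have "x i = y i" "x j = y j" "?\<pi> x = ?\<pi> y" by simp_all
      then show "x = y" unfolding \<pi>_eq by (intro ext) metis
    qed
    fix p assume "p \<in> grid2 k \<times> ?\<pi> ` grid k"
    then obtain a b x where p: "p = ((a, b), ?\<pi> x)" "a < k" "b < k" "x \<in> grid k" by auto
    then have "x(i := a, j := b) \<in> grid k" unfolding grid_def by simp
    moreover have "?\<pi> (x(i := a, j := b)) = ?\<pi> x" unfolding \<pi>_eq by simp
    ultimately show "p \<in> (\<lambda>x. ((x i, x j), ?\<pi> x)) ` grid k"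
      using p ij by (intro image_eqI[of _ _ "x(i := a, j := b)"]) simp_all
  qed (auto simp: grid_def)
  fix x y :: "'n \<Rightarrow> nat"
  show "grid_adj x y \<longleftrightarrow>
      path2 (x i, x j) (y i, y j) \<and> ?\<pi> x = ?\<pi> y \<or> (x i, x j) = (y i, y j) \<and> grid_adj (?\<pi> x) (?\<pi> y)"
    (is "?L \<longleftrightarrow> ?R")
  proof
    assume ?L
    then obtain m where m: "\<And>l. l \<noteq> m \<Longrightarrow> x l = y l" "path_rel (x m) (y m)"
      unfolding grid_adj_def by blast
    show ?R
    proof (cases "m = i \<or> m = j")
      case True
      then have "?\<pi> x = ?\<pi> y" unfolding \<pi>_eq using m by blast
      then show ?thesis using True m m(1)[of i] m(1)[of j] ij by (auto simp: path2_def)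
    next
      case False
      then have "grid_adj (?\<pi> x) (?\<pi> y)" unfolding grid_adj_def using m by (intro exI[of _ m]) simp
      moreover have "x i = y i" "x j = y j" using m(1) False by auto
      ultimately show ?thesis by simp
    qed
  next
    assume ?R
    then show ?L
    proof (elim disjE conjE)
      assume "path2 (x i, x j) (y i, y j)" "?\<pi> x = ?\<pi> y"
      then show ?L unfolding grid_adj_def path2_def \<pi>_eq by auto
    next
      assume xy: "(x i, x j) = (y i, y j)" and "grid_adj (?\<pi> x) (?\<pi> y)"
      then obtain m where m: "\<And>l. l \<noteq> m \<Longrightarrow> ?\<pi> x l = ?\<pi> y l" "path_rel (?\<pi> x m) (?\<pi> y m)"
        unfolding grid_adj_def by blast
      have "x l = y l" if "l \<noteq> m" for l using m(1)[OF that] xy by (simp split: if_splits)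
      moreover have "path_rel (x m) (y m)" using m(2) xy by (simp split: if_splits)
      ultimately show ?L unfolding grid_adj_def by blast
    qed
  qed
qed

text \<open>
  Stability under compression in one coordinate and in pairs of coordinates. In dimension one, where
  there are no pairs, the first clause carries all the content.
\<close>

definition compressed :: "nat \<Rightarrow> ('n \<Rightarrow> nat) set \<Rightarrow> bool" where
  "compressed k A \<longleftrightarrow>
     (\<forall>i. \<forall>x\<in>A. \<forall>y\<in>grid k. (\<forall>l. l \<noteq> i \<longrightarrow> x l = y l) \<longrightarrow> y i < x i \<longrightarrow> y \<in> A) \<and>
     (\<forall>i j. i \<noteq> j \<longrightarrow> (\<forall>x\<in>A. \<forall>y\<in>grid k. (\<forall>l. l \<noteq> i \<longrightarrow> l \<noteq> j \<longrightarrow> x l = y l) \<longrightarrow>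
        y i + y j < x i + x j \<longrightarrow> y \<in> A))"

lemma compressed_coordD:
  "\<lbrakk>compressed k A; x \<in> A; y \<in> grid k; \<And>l. l \<noteq> i \<Longrightarrow> x l = y l; y i < x i\<rbrakk> \<Longrightarrow> y \<in> A"
  unfolding compressed_def by blast

lemma compressed_pairD:
  "\<lbrakk>compressed k A; i \<noteq> j; x \<in> A; y \<in> grid k; \<And>l. l \<noteq> i \<Longrightarrow> l \<noteq> j \<Longrightarrow> x l = y l;
    y i + y j < x i + x j\<rbrakk> \<Longrightarrow> y \<in> A"
  unfolding compressed_def by blast

text \<open>
  The minimiser of the sum of all coordinates among sets with the same size and neighbourhoods that are no
  larger: if it were not compressed, \<open>improve\<close> would produce a better one.
\<close>

lemma compressed_exists:
  fixes A :: "('n::finite \<Rightarrow> nat) set"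
  assumes A: "A \<subseteq> grid k"
  obtains A' :: "('n \<Rightarrow> nat) set" where "A' \<subseteq> grid k" "card A' = card A" "compressed k A'"
    "\<And>t. card ((nbhd (grid k) grid_adj ^^ t) A') \<le> card ((nbhd (grid k) grid_adj ^^ t) A)"
proof -
  let ?N = "nbhd (grid k :: ('n \<Rightarrow> nat) set) grid_adj"
  let ?Q = "\<lambda>T. T \<subseteq> grid k \<and> card T = card A \<and> (\<forall>t. card ((?N ^^ t) T) \<le> card ((?N ^^ t) A))"
  obtain T where T: "?Q T" and min: "\<And>T'. ?Q T' \<Longrightarrow> sum coord_sum T \<le> sum coord_sum T'"
    using ex_has_least_nat[of ?Q A "sum coord_sum"] A by auto
  have stuck: False
    if imp: "\<exists>T'\<subseteq>grid k. card T' = card T \<and> sum coord_sum T' < sum coord_sum T \<and>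
               (\<forall>t. card ((?N ^^ t) T') \<le> card ((?N ^^ t) T))"
  proof -
    obtain T' where T': "T' \<subseteq> grid k" "card T' = card T" "sum coord_sum T' < sum coord_sum T"
        "\<And>t. card ((?N ^^ t) T') \<le> card ((?N ^^ t) T)"
      using imp by metis
    have "?Q T'" using T' T order_trans by metis
    then show False using min[of T'] T'(3) by simp
  qed
  have "y \<in> T" if "x \<in> T" "y \<in> grid k" and eq: "\<And>l. l \<noteq> i \<Longrightarrow> x l = y l" and lt: "y i < x i" for i x y
  proof (rule ccontr)
    assume ny: "y \<notin> T"
    show False
    proof (rule stuck, rule compression.improve[OF compression_coord[of k i], of coord_sum T x y])
      show "x(i := 0) = y(i := 0)" using eq by auto
      then show "coord_sum y < coord_sum x" using lt coord_sum_zero1[of x i] coord_sum_zero1[of y i] by simp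
      fix u v :: "'n \<Rightarrow> nat" and w assume "u(i := 0) = v(i := 0)" "u i \<in> {..<min w k}" "v i \<notin> {..<min w k}"
      then show "coord_sum u \<le> coord_sum v" using coord_sum_zero1[of u i] coord_sum_zero1[of v i] by (cases "v i < w") auto
    qed (use that ny T in simp_all)
  qed
  moreover have "y \<in> T" if ij: "i \<noteq> j" and "x \<in> T" "y \<in> grid k"
    and eq: "\<And>l. l \<noteq> i \<Longrightarrow> l \<noteq> j \<Longrightarrow> x l = y l" and lt: "y i + y j < x i + x j" for i j x y
  proof (rule ccontr)
    assume ny: "y \<notin> T"
    show False
    proof (rule stuck, rule compression.improve[OF compression_pair[OF ij, of k], of coord_sum T x y])
      show "x(i := 0, j := 0) = y(i := 0, j := 0)" using eq by auto
      then show "coord_sum y < coord_sum x" using lt coord_sum_zero2[OF ij, of x] coord_sum_zero2[OF ij, of y] by simp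
      fix u v :: "'n \<Rightarrow> nat" and w
      assume uv: "u(i := 0, j := 0) = v(i := 0, j := 0)" "(u i, u j) \<in> initial2 k w" "(v i, v j) \<notin> initial2 k w"
        and "v \<in> grid k"
      then have "(v i, v j) \<in> grid2 k" unfolding grid_def by simp
      then have "\<not> sum2 (v i, v j) < sum2 (u i, u j)" using initial2_closed[OF uv(2)] uv(3) by blast
      then show "coord_sum u \<le> coord_sum v"
        using uv(1) coord_sum_zero2[OF ij, of u] coord_sum_zero2[OF ij, of v] by (simp add: sum2_def)
    qed (use that ny T in simp_all)
  qed
  ultimately have "compressed k T" unfolding compressed_def by blast
  then show ?thesis by (intro that[where A' = T]) (use T in simp_all)
qed

lemma compressed_down:
  fixes A :: "('n::finite \<Rightarrow> nat) set"
  assumes "compressed k A" and "x \<in> A" and "y \<in> grid k" and "\<And>l. y l \<le> x l" and "A \<subseteq> grid k"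
  shows "y \<in> A"
  using assms(2,4)
proof (induction "card {l. x l \<noteq> y l}" arbitrary: x rule: less_induct)
  case less
  show ?case
  proof (cases "x = y")
    case False
    then obtain i where i: "x i \<noteq> y i" by (auto simp: fun_eq_iff)
    have xi: "y i < x i" using i less.prems(2)[of i] by simp
    let ?x = "x(i := y i)"
    have "?x \<in> grid k" using less.prems(1) assms(3,5) unfolding grid_def by auto
    then have "?x \<in> A"
      using xi by (intro compressed_coordD[OF assms(1) less.prems(1), of _ i]) auto
    moreover have "card {l. ?x l \<noteq> y l} < card {l. x l \<noteq> y l}"
      using i by (intro psubset_card_mono) auto
    ultimately show ?thesis using less.hyps[of ?x] less.prems(2) by simp
  qed (use less.prems in simp)
qed

text \<open>
  Induction on the number of coordinates in which \<open>x\<close> and \<open>y\<close> differ. If \<open>x\<close> has a coordinate that is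
  too small and one that is too large, moving mass from the latter to the former until one of
  the two is correct costs one unit of the coordinate sum and repairs a coordinate, so the
  hypothesis is preserved.
\<close>

lemma compressed_absorbs:
  fixes A :: "('n::finite \<Rightarrow> nat) set"
  assumes c: "compressed k A" and AG: "A \<subseteq> grid k" and "x \<in> A" and y: "y \<in> grid k"
    and "card {l. x l \<noteq> y l} + coord_sum y \<le> coord_sum x"
  shows "y \<in> A"
  using assms(3,5)
proof (induction "card {l. x l \<noteq> y l}" arbitrary: x rule: less_induct)
  case less
  show ?case
  proof (cases "\<forall>l. y l \<le> x l")
    case True
    then show ?thesis using compressed_down[OF c less.prems(1) y _ AG] by blast
  next
    case False
    then obtain j where j: "x j < y j" by (meson not_less)
    have "\<exists>i. y i < x i"
    proof (rule ccontr)
      assume "\<not> ?thesis"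
      then have "coord_sum x < coord_sum y"
        unfolding coord_sum_def using j by (intro sum_strict_mono_ex1) (auto simp: not_less)
      then show False using less.prems(2) by simp
    qed
    then obtain i where i: "y i < x i" by blast
    have ij: "i \<noteq> j" using i j by auto
    have xk: "x l < k" "y l < k" for l using less.prems(1) AG y unfolding grid_def by auto
    \<comment> \<open>The amount \<open>e\<close> moved from \<open>i\<close> to \<open>j\<close>, in addition to the unit lost at \<open>i\<close>, is the largest that
      overshoots neither target value.\<close>
    define e where "e = min (x i - Suc (y i)) (y j - x j)"
    define x' where "x' = x(i := x i - Suc e, j := x j + e)"
    have e: "Suc e \<le> x i" "x j + e \<le> y j" using i j unfolding e_def by auto
    have "x' \<in> grid k" using xk e unfolding x'_def grid_def
      by (auto intro: le_less_trans[OF _ xk(2)] less_imp_diff_less)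
    then have x'A: "x' \<in> A"
      using ij e by (intro compressed_pairD[OF c ij less.prems(1)]) (auto simp: x'_def)
    have tot: "coord_sum x' + 1 = coord_sum x"
      using coord_sum_zero2[OF ij, of x] coord_sum_zero2[OF ij, of x'] ij e unfolding x'_def
      by (simp add: fun_upd_twist)
    have "x' i = y i \<or> x' j = y j" using i j ij unfolding x'_def e_def by (auto simp: min_def)
    then obtain m where m: "x' m = y m" "x m \<noteq> y m"
      using less_imp_neq[OF i] less_imp_neq[OF j] by metis
    have keep: "x l \<noteq> y l" if "x' l \<noteq> y l" for l
      using that i j unfolding x'_def by (cases "l = i"; cases "l = j") simp_all
    have "{l. x' l \<noteq> y l} \<subset> {l. x l \<noteq> y l}"
    proof (rule psubsetI)
      show "{l. x' l \<noteq> y l} \<subseteq> {l. x l \<noteq> y l}" using keep by (rule Collect_mono[OF impI])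
      have "m \<in> {l. x l \<noteq> y l}" "m \<notin> {l. x' l \<noteq> y l}" using m by simp_all
      then show "{l. x' l \<noteq> y l} \<noteq> {l. x l \<noteq> y l}" by metis
    qed
    then have cd: "card {l. x' l \<noteq> y l} < card {l. x l \<noteq> y l}" by (intro psubset_card_mono) auto
    then show ?thesis using less.hyps[OF cd x'A] less.prems(2) tot by simp
  qed
qed

lemma ball_grows:
  fixes B :: "('n::finite \<Rightarrow> nat) set"
  assumes B: "{x \<in> grid k. coord_sum x \<le> m} \<subseteq> B"
  shows "{x \<in> grid k. coord_sum x \<le> m + t} \<subseteq> (nbhd (grid k) grid_adj ^^ t) B"
proof (induction t)
  case (Suc t)
  let ?N = "nbhd (grid k :: ('n \<Rightarrow> nat) set) grid_adj"
  show ?case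
  proof
    fix x :: "'n \<Rightarrow> nat" assume x: "x \<in> {x \<in> grid k. coord_sum x \<le> m + Suc t}"
    show "x \<in> (?N ^^ Suc t) B"
    proof (cases "coord_sum x \<le> m + t")
      case True
      then have "x \<in> (?N ^^ t) B" using Suc x by blast
      then show ?thesis using x by (auto intro!: nbhdI[where y = x])
    next
      case False
      then have "coord_sum x \<noteq> 0" by simp
      then obtain i where i: "x i > 0" unfolding coord_sum_def by auto
      let ?x = "x(i := x i - 1)"
      have "?x \<in> {x \<in> grid k. coord_sum x \<le> m + t}"
        using x i coord_sum_upd[of x i "x i - 1"] unfolding grid_def by (auto intro: less_imp_diff_less)
      then have "?x \<in> (?N ^^ t) B" using Suc by blast
      moreover have "grid_adj ?x x" unfolding grid_adj_def path_rel_def by (intro exI[of _ i]) auto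
      ultimately show ?thesis using x by (auto intro!: nbhdI[where y = ?x])
    qed
  qed
qed (use B in simp)

text \<open>
  If the compressed competitor \<open>A'\<close> missed a point \<open>y\<close> of coordinate sum at most \<open>M - n\<close>, all of its
  points would have coordinate sum below that of \<open>y\<close> plus \<open>n\<close>. As \<open>y\<close> itself is one of the grid
  points with that property, \<open>A'\<close> would have fewer points than \<open>{x. coord_sum x < M}\<close>.
\<close>

theorem grid_isoperimetry:
  fixes A :: "('n::finite \<Rightarrow> nat) set"
  assumes A: "A \<subseteq> grid k" and M: "CARD('n) \<le> M"
    and card: "card {x \<in> grid k :: ('n \<Rightarrow> nat) set. coord_sum x < M} \<le> card A"
  shows "card {x \<in> grid k :: ('n \<Rightarrow> nat) set. coord_sum x + CARD('n) \<le> M + t}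
      \<le> card ((nbhd (grid k) grid_adj ^^ t) A)"
proof -
  obtain A' :: "('n \<Rightarrow> nat) set" where A': "A' \<subseteq> grid k" "card A' = card A" "compressed k A'"
    "\<And>t. card ((nbhd (grid k) grid_adj ^^ t) A') \<le> card ((nbhd (grid k) grid_adj ^^ t) A)"
    by (rule compressed_exists[OF A]) blast
  have "{x \<in> grid k. coord_sum x \<le> M - CARD('n)} \<subseteq> A'"
  proof
    fix y :: "'n \<Rightarrow> nat" assume y: "y \<in> {x \<in> grid k. coord_sum x \<le> M - CARD('n)}"
    show "y \<in> A'"
    proof (rule ccontr)
      assume ny: "y \<notin> A'"
      let ?T = "{x \<in> grid k :: ('n \<Rightarrow> nat) set. coord_sum x < coord_sum y + CARD('n)}"
      have "A' \<subseteq> ?T - {y}"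
      proof
        fix x assume x: "x \<in> A'"
        have "card {l. x l \<noteq> y l} \<le> CARD('n)" by (intro card_mono) auto
        moreover have "\<not> card {l. x l \<noteq> y l} + coord_sum y \<le> coord_sum x"
          using compressed_absorbs[OF A'(3,1) x] y ny by blast
        ultimately have "coord_sum x < coord_sum y + CARD('n)" by linarith
        then show "x \<in> ?T - {y}" using x ny A'(1) by auto
      qed
      then have "card A' \<le> card (?T - {y})" by (rule card_mono[rotated]) (simp add: finite_grid)
      also have "\<dots> < card ?T"
      proof (rule card_Diff1_less)
        show "finite ?T" by (simp add: finite_grid)
        show "y \<in> ?T" using y by simp
      qed
      also have "\<dots> \<le> card {x \<in> grid k :: ('n \<Rightarrow> nat) set. coord_sum x < M}"
      proof (rule card_mono)
        show "finite {x \<in> grid k :: ('n \<Rightarrow> nat) set. coord_sum x < M}" by (simp add: finite_grid)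
        show "?T \<subseteq> {x \<in> grid k. coord_sum x < M}" using y M by auto
      qed
      finally show False using card A'(2) by simp
    qed
  qed
  then have "{x \<in> grid k. coord_sum x \<le> M - CARD('n) + t} \<subseteq> (nbhd (grid k) grid_adj ^^ t) A'"
    by (rule ball_grows)
  then have "card {x \<in> grid k :: ('n \<Rightarrow> nat) set. coord_sum x \<le> M - CARD('n) + t}
      \<le> card ((nbhd (grid k) grid_adj ^^ t) A')"
    by (rule card_mono[OF finite_subset[OF nbhd_funpow_subset[OF A'(1)] finite_grid]])
  moreover have "coord_sum x + CARD('n) \<le> M + t \<longleftrightarrow> coord_sum x \<le> M - CARD('n) + t" for x :: "'n \<Rightarrow> nat"
    using M by auto
  ultimately show ?thesis using A'(4)[of t] by simp
qed

section \<open>From the grid to the cube\<close>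

text \<open>
  Half-open cells, so that those indexed by \<open>grid k\<close> partition the half-open cube exactly.
\<close>

definition cell :: "nat \<Rightarrow> ('n \<Rightarrow> nat) \<Rightarrow> (real ^ 'n) set" where
  "cell k x = {u. \<forall>i. real (x i) \<le> real k * u $ i \<and> real k * u $ i < real (x i) + 1}"

definition half_cube :: "(real ^ 'n) set" where
  "half_cube = {u. \<forall>i. 0 \<le> u $ i \<and> u $ i < 1}"

text \<open>
  The part of the open \<open>l\<^sup>1\<close>-ball of radius \<open>c\<close> around the origin that lies in the half-open cube.
\<close>

definition corner :: "real \<Rightarrow> (real ^ 'n) set" where
  "corner c = {u \<in> half_cube. (\<Sum>i\<in>UNIV. u $ i) < c}"

lemma borel_half_open_box:
  fixes a b :: "'n::finite \<Rightarrow> real"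
  shows "{u :: real ^ 'n. \<forall>i. a i \<le> c * u $ i \<and> c * u $ i < b i} \<in> sets borel"
proof -
  have "{u :: real ^ 'n. \<forall>i. a i \<le> c * u $ i \<and> c * u $ i < b i}
      = (\<Inter>i. {u. a i \<le> c * u $ i}) \<inter> (\<Inter>i. {u. c * u $ i < b i})"
    by auto
  moreover have "closed (\<Inter>i. {u :: real ^ 'n. a i \<le> c * u $ i})"
    by (intro closed_INT ballI closed_Collect_le continuous_intros)
  moreover have "open (\<Inter>i. {u :: real ^ 'n. c * u $ i < b i})"
    by (intro open_INT ballI open_Collect_less continuous_intros finite)
  ultimately show ?thesis by auto
qed

lemma half_cube_subset: "half_cube \<subseteq> unit_cube"
  unfolding half_cube_def unit_cube_def by (auto intro: less_imp_le)

lemma unit_cube_eq_cbox: "unit_cube = (cbox 0 1 :: (real ^ 'n::finite) set)"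
  unfolding unit_cube_def by (auto simp: mem_box_cart)

lemma half_cube_sets: "half_cube \<in> sets (lebesgue :: (real ^ 'n::finite) measure)"
  using borel_half_open_box[of "\<lambda>_::'n. 0" 1 "\<lambda>_. 1"] unfolding half_cube_def by simp

lemma unit_cube_subset_lmeasurable:
  assumes "S \<subseteq> unit_cube" "S \<in> sets (lebesgue :: (real ^ 'n::finite) measure)"
  shows "S \<in> lmeasurable"
proof (rule bounded_set_imp_lmeasurable)
  show "bounded S" using assms(1) bounded_cbox bounded_subset unfolding unit_cube_eq_cbox by blast
qed fact

lemma negligible_unit_cube_diff: "negligible (unit_cube - half_cube :: (real ^ 'n::finite) set)"
proof (rule negligible_subset[OF negligible_frontier_interval])
  show "unit_cube - half_cube \<subseteq> cbox 0 1 - (box 0 1 :: (real ^ 'n) set)"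
    unfolding unit_cube_eq_cbox half_cube_def by (auto simp: mem_box_cart intro: less_imp_le)
qed

lemma corner_lmeasurable: "corner c \<in> (lmeasurable :: (real ^ 'n::finite) set set)"
proof (rule unit_cube_subset_lmeasurable)
  show "corner c \<subseteq> unit_cube" using half_cube_subset unfolding corner_def by blast
  have "open {u :: real ^ 'n. (\<Sum>i\<in>UNIV. u $ i) < c}"
    by (intro open_Collect_less continuous_intros)
  then have "half_cube \<inter> {u :: real ^ 'n. (\<Sum>i\<in>UNIV. u $ i) < c} \<in> sets lebesgue"
    using half_cube_sets by (intro sets.Int) auto
  then show "corner c \<in> sets (lebesgue :: (real ^ 'n) measure)" unfolding corner_def by (simp add: Int_def)
qed

lemma cell_lmeasurable:
  assumes "k > 0"
  shows "cell k x \<in> (lmeasurable :: (real ^ 'n::finite) set set)"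
proof (rule bounded_set_imp_lmeasurable)
  have "cell k x \<subseteq> cbox (\<chi> i. real (x i) / real k) (\<chi> i. (real (x i) + 1) / real k)"
  proof
    fix u assume u: "u \<in> cell k x"
    have "real (x i) \<le> real k * u $ i" "real k * u $ i \<le> real (x i) + 1" for i
      using u unfolding cell_def by (auto simp: less_imp_le)
    then show "u \<in> cbox (\<chi> i. real (x i) / real k) (\<chi> i. (real (x i) + 1) / real k)"
      using assms by (simp add: mem_box_cart field_simps)
  qed
  then show "bounded (cell k x)" using bounded_cbox bounded_subset by blast
  show "cell k x \<in> sets lebesgue" unfolding cell_def using borel_half_open_box by simp
qed

text \<open>
  Equality of the volumes makes the measure of a union of cells proportional to the number of its
  grid points, which is how counting enters.
\<close>

lemma measure_cell:
  fixes x :: "'n::finite \<Rightarrow> nat"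
  assumes "k > 0"
  shows "measure lebesgue (cell k x) = measure lebesgue (cell k (\<lambda>_::'n. 0))"
proof -
  let ?a = "\<chi> i. real (x i) / real k"
  have "cell k x = (+) ?a ` cell k (\<lambda>_::'n. 0)"
  proof (intro equalityI subsetI)
    fix u assume "u \<in> cell k x"
    then have "u - ?a \<in> cell k (\<lambda>_::'n. 0)" using assms unfolding cell_def by (auto simp: algebra_simps)
    then show "u \<in> (+) ?a ` cell k (\<lambda>_::'n. 0)" by (intro image_eqI[of _ _ "u - ?a"]) auto
  qed (use assms in \<open>auto simp: cell_def distrib_left\<close>)
  then show ?thesis by (simp add: measure_translation)
qed

lemma cell_disjoint: "u \<in> cell k x \<Longrightarrow> u \<in> cell k y \<Longrightarrow> x = y"
proof (rule ext)
  fix i assume "u \<in> cell k x" "u \<in> cell k y"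
  then have "real (x i) < real (y i) + 1" "real (y i) < real (x i) + 1"
    unfolding cell_def by (metis (mono_tags, lifting) le_less_trans mem_Collect_eq)+
  then show "x i = y i" by linarith
qed

lemma measure_cells:
  fixes S :: "('n::finite \<Rightarrow> nat) set"
  assumes "k > 0" "finite S"
  shows "(\<Union>x\<in>S. cell k x) \<in> lmeasurable"
    and "measure lebesgue (\<Union>x\<in>S. cell k x) = card S * measure lebesgue (cell k (\<lambda>_::'n. 0))"
proof -
  show "(\<Union>x\<in>S. cell k x) \<in> lmeasurable"
    using assms by (intro fmeasurable.finite_UN cell_lmeasurable)
  have "pairwise (\<lambda>x y. disjnt (cell k x) (cell k y)) S"
    unfolding pairwise_def disjnt_def using cell_disjoint by blast
  then have "measure lebesgue (\<Union>x\<in>S. cell k x) = (\<Sum>x\<in>S. measure lebesgue (cell k x))"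
    using assms by (intro measure_UNION' cell_lmeasurable)
  also have "\<dots> = (\<Sum>x\<in>S. measure lebesgue (cell k (\<lambda>_::'n. 0)))"
    by (intro sum.cong refl measure_cell assms(1))
  finally show "measure lebesgue (\<Union>x\<in>S. cell k x) = card S * measure lebesgue (cell k (\<lambda>_::'n. 0))"
    by simp
qed

lemma half_cube_cell:
  assumes "k > 0" "u \<in> half_cube"
  obtains x where "x \<in> grid k" "u \<in> cell k x"
proof
  define x where "x i = nat \<lfloor>real k * u $ i\<rfloor>" for i
  have u: "0 \<le> real k * u $ i" "real k * u $ i < real k" for i
    using assms unfolding half_cube_def by auto
  have x: "real (x i) \<le> real k * u $ i" "real k * u $ i < real (x i) + 1" for i
    using u(1)[of i] unfolding x_def by linarith+
  show "u \<in> cell k x" using x unfolding cell_def by blast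
  have "real (x i) < real k" for i using x(1)[of i] u(2)[of i] by linarith
  then show "x \<in> grid k" unfolding grid_def by simp
qed

lemma cell_subset_half_cube: "k > 0 \<Longrightarrow> x \<in> grid k \<Longrightarrow> cell k x \<subseteq> half_cube"
proof
  fix u :: "real ^ 'a" assume k: "k > 0" and x: "x \<in> grid k" and u: "u \<in> cell k x"
  have "0 \<le> u $ i \<and> u $ i < 1" for i
  proof -
    have ui: "real (x i) \<le> real k * u $ i" "real k * u $ i < real (x i) + 1"
      using u unfolding cell_def by auto
    have "x i < k" using x unfolding grid_def by simp
    then have "real (x i) + 1 \<le> real k" by linarith
    then have "real k * u $ i < real k * 1" using ui by linarith
    moreover have "real k * 0 \<le> real k * u $ i" using ui by simp
    ultimately show ?thesis using k by (metis mult_le_cancel_left_pos mult_less_cancel_left_pos of_nat_0_less_iff)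
  qed
  then show "u \<in> half_cube" unfolding half_cube_def by blast
qed

lemma cell_coord_sum:
  fixes u :: "real ^ 'n::finite"
  assumes "u \<in> cell k x"
  shows "real (coord_sum x) \<le> real k * (\<Sum>i\<in>UNIV. u $ i)"
    and "real k * (\<Sum>i\<in>UNIV. u $ i) \<le> real (coord_sum x) + CARD('n)"
proof -
  have "(\<Sum>i\<in>UNIV. real (x i)) \<le> (\<Sum>i\<in>UNIV. real k * u $ i)"
    using assms unfolding cell_def by (intro sum_mono) simp
  then show "real (coord_sum x) \<le> real k * (\<Sum>i\<in>UNIV. u $ i)"
    unfolding coord_sum_def by (simp add: sum_distrib_left)
  have "(\<Sum>i\<in>UNIV. real k * u $ i) \<le> (\<Sum>i\<in>UNIV. real (x i) + 1)"
    using assms unfolding cell_def by (intro sum_mono) (auto intro: less_imp_le)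
  then show "real k * (\<Sum>i\<in>UNIV. u $ i) \<le> real (coord_sum x) + CARD('n)"
    unfolding coord_sum_def by (simp add: sum_distrib_left sum.distrib)
qed

lemma nbhd_funpow_dist:
  fixes x :: "'n::finite \<Rightarrow> nat"
  assumes "x \<in> (nbhd (grid k) grid_adj ^^ t) A"
  shows "\<exists>y\<in>A. (\<Sum>i\<in>UNIV. \<bar>real (x i) - real (y i)\<bar>) \<le> real t"
  using assms
proof (induction t arbitrary: x)
  case 0
  then show ?case by (intro bexI[of _ x]) simp_all
next
  case (Suc t)
  then obtain z where z: "z \<in> (nbhd (grid k) grid_adj ^^ t) A" "grid_adj z x"
    unfolding nbhd_def by auto
  then obtain y where y: "y \<in> A" "(\<Sum>i\<in>UNIV. \<bar>real (z i) - real (y i)\<bar>) \<le> real t"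
    using Suc.IH by blast
  obtain m where m: "\<And>l. l \<noteq> m \<Longrightarrow> z l = x l" "path_rel (z m) (x m)"
    using z(2) unfolding grid_adj_def by blast
  have "(\<Sum>i\<in>UNIV. \<bar>real (x i) - real (z i)\<bar>) = (\<Sum>i\<in>UNIV. if i = m then \<bar>real (x m) - real (z m)\<bar> else 0)"
    using m(1) by (intro sum.cong) auto
  also have "\<dots> \<le> 1" using m(2) unfolding path_rel_def by auto
  finally have "(\<Sum>i\<in>UNIV. \<bar>real (x i) - real (z i)\<bar>) \<le> 1" .
  moreover have "(\<Sum>i\<in>UNIV. \<bar>real (x i) - real (y i)\<bar>)
      \<le> (\<Sum>i\<in>UNIV. \<bar>real (x i) - real (z i)\<bar> + \<bar>real (z i) - real (y i)\<bar>)"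
    by (intro sum_mono) linarith
  ultimately show ?case using y by (intro bexI[of _ y]) (simp_all add: sum.distrib)
qed

lemma l1_dist_cells:
  fixes u w :: "real ^ 'n::finite"
  assumes k: "k > 0" and u: "u \<in> cell k x" and w: "w \<in> cell k y"
  shows "real k * l1_dist u w \<le> (\<Sum>i\<in>UNIV. \<bar>real (x i) - real (y i)\<bar>) + CARD('n)"
proof -
  have "real k * \<bar>u $ i - w $ i\<bar> \<le> \<bar>real (x i) - real (y i)\<bar> + 1" for i
  proof -
    have "real k * \<bar>u $ i - w $ i\<bar> = \<bar>real k * u $ i - real k * w $ i\<bar>"
      using k by (simp add: abs_mult flip: right_diff_distrib)
    moreover have "real (x i) \<le> real k * u $ i" "real k * u $ i < real (x i) + 1"
      "real (y i) \<le> real k * w $ i" "real k * w $ i < real (y i) + 1"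
      using u w unfolding cell_def by auto
    ultimately show ?thesis by linarith
  qed
  then have "(\<Sum>i\<in>UNIV. real k * \<bar>u $ i - w $ i\<bar>) \<le> (\<Sum>i\<in>UNIV. \<bar>real (x i) - real (y i)\<bar> + 1)"
    by (intro sum_mono) blast
  then show ?thesis unfolding l1_dist_def by (simp add: sum_distrib_left sum.distrib)
qed

lemma l1_infdist_less_iff:
  assumes "A \<noteq> {}"
  shows "l1_infdist u A < r \<longleftrightarrow> (\<exists>w\<in>A. l1_dist u w < r)"
proof -
  have "bdd_below (l1_dist u ` A)"
    by (intro bdd_belowI[of _ 0]) (auto simp: l1_dist_def sum_nonneg)
  then show ?thesis unfolding l1_infdist_def using assms by (simp add: cINF_less_iff)
qed

text \<open>
  The neighbourhood is relatively open in the cube, being a union of \<open>l\<^sup>1\<close>-balls.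
\<close>

lemma l1_nbhd_lmeasurable:
  fixes A :: "(real ^ 'n::finite) set"
  assumes "A \<noteq> {}"
  shows "l1_nbhd r A \<in> lmeasurable"
proof (rule unit_cube_subset_lmeasurable)
  show "l1_nbhd r A \<subseteq> unit_cube" unfolding l1_nbhd_def by blast
  have "l1_nbhd r A = unit_cube \<inter> (\<Union>w\<in>A. {u. l1_dist u w < r})"
    unfolding l1_nbhd_def using l1_infdist_less_iff[OF assms] by auto
  moreover have "open (\<Union>w\<in>A. {u. l1_dist u w < r})"
    unfolding l1_dist_def by (intro open_UN ballI open_Collect_less continuous_intros)
  moreover have "unit_cube \<in> sets (lebesgue :: (real ^ 'n) measure)"
    unfolding unit_cube_eq_cbox by simp
  ultimately show "l1_nbhd r A \<in> sets lebesgue" by (auto intro!: sets.Int)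
qed

lemma corner_mono: "a \<le> b \<Longrightarrow> corner a \<subseteq> corner b"
  unfolding corner_def by auto

text \<open>
  The grid inequality, applied to the set \<open>A\<close> of cells meeting \<open>\<Omega>\<close>. The radius \<open>M\<close> is
  chosen so that the cells with \<open>coord_sum x < M\<close> lie in \<open>corner s\<close>, and the number \<open>t\<close> of steps so that
  \<open>t\<close> grid steps and the diameters of two cells together stay below \<open>r\<close>. Rounding costs
  \<open>n + 1\<close> in \<open>M\<close>, \<open>n + 2\<close> in \<open>t\<close>, and \<open>n\<close> in the grid inequality itself, which gives the shift
  \<open>(3 n + 3) / k\<close>.
\<close>

lemma corner_enlargement_approx:
  fixes \<Omega> :: "(real ^ 'n::finite) set"
  assumes \<Omega>: "\<Omega> \<subseteq> unit_cube" "\<Omega> \<in> lmeasurable" and pos: "measure lebesgue \<Omega> > 0"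
    and le: "measure lebesgue (corner s :: (real ^ 'n) set) \<le> measure lebesgue \<Omega>"
    and k: "k > 0" "2 * CARD('n) \<le> s * real k" "CARD('n) + 1 \<le> r * real k"
  shows "measure lebesgue (corner (s + r - (3 * CARD('n) + 3) / real k) :: (real ^ 'n) set)
      \<le> measure lebesgue (l1_nbhd r \<Omega>)"
proof -
  let ?n = "CARD('n)" and ?G = "grid k :: ('n \<Rightarrow> nat) set"
  let ?m = "measure lebesgue (cell k (\<lambda>_::'n. 0))"
  let ?cells = "\<lambda>S. \<Union>x\<in>S. cell k x"
  define M where "M = nat (\<lfloor>s * real k\<rfloor> - int ?n)"
  define t where "t = nat (\<lfloor>r * real k\<rfloor> - int ?n - 1)"
  have "int (2 * ?n) \<le> \<lfloor>s * real k\<rfloor>" using k(2) by linarith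
  then have M: "?n \<le> M" "real M + ?n \<le> s * real k" "s * real k - 1 < real M + ?n"
    unfolding M_def by linarith+
  have "int (?n + 1) \<le> \<lfloor>r * real k\<rfloor>" using k(3) by linarith
  then have t: "real t + ?n + 1 \<le> r * real k" "r * real k - 1 < real t + ?n + 1"
    unfolding t_def by linarith+
  define A where "A = {x \<in> ?G. cell k x \<inter> \<Omega> \<noteq> {}}"
  have A: "A \<subseteq> ?G" unfolding A_def by blast
  note finG = finite_subset[OF _ finite_grid]
  have ne: "\<Omega> \<noteq> {}" using pos by auto
  have \<Omega>_le: "measure lebesgue \<Omega> \<le> card A * ?m"
  proof -
    have "measure lebesgue \<Omega> = measure lebesgue (\<Omega> \<inter> half_cube)"
    proof (rule measure_negligible_symdiff[symmetric])
      show "\<Omega> \<in> lmeasurable" by (rule \<Omega>(2))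
      have "(\<Omega> - \<Omega> \<inter> half_cube) \<union> (\<Omega> \<inter> half_cube - \<Omega>) \<subseteq> unit_cube - half_cube" using \<Omega>(1) by blast
      then show "negligible ((\<Omega> - \<Omega> \<inter> half_cube) \<union> (\<Omega> \<inter> half_cube - \<Omega>))"
        by (rule negligible_subset[OF negligible_unit_cube_diff])
    qed
    also have "\<dots> \<le> measure lebesgue (?cells A)"
    proof (rule measure_mono_fmeasurable)
      show "\<Omega> \<inter> half_cube \<subseteq> ?cells A"
      proof
        fix u assume u: "u \<in> \<Omega> \<inter> half_cube"
        then obtain x where "x \<in> ?G" "u \<in> cell k x" using half_cube_cell[OF k(1)] by blast
        then show "u \<in> ?cells A" using u unfolding A_def by blast
      qed
      show "\<Omega> \<inter> half_cube \<in> sets lebesgue" using \<Omega>(2) half_cube_sets by (intro sets.Int) auto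
    qed (rule measure_cells(1)[OF k(1) finG[OF A]])
    also have "\<dots> = card A * ?m" by (rule measure_cells(2)[OF k(1) finG[OF A]])
    finally show ?thesis .
  qed
  \<comment> \<open>The common volume of the cells is positive because finitely many of them cover \<open>\<Omega>\<close> up to a null
    set; it can therefore be cancelled.\<close>
  have "?m \<noteq> 0"
  proof
    assume "?m = 0"
    then have "measure lebesgue \<Omega> \<le> 0" using \<Omega>_le by simp
    then show False using pos by linarith
  qed
  then have mpos: "?m > 0" by (simp add: zero_less_measure_iff)
  have "card {x \<in> ?G. coord_sum x < M} \<le> card A"
  proof -
    let ?S = "{x \<in> ?G. coord_sum x < M}"
    have fS: "finite ?S" by (rule finG) blast
    have "card ?S * ?m = measure lebesgue (?cells ?S)" by (rule measure_cells(2)[OF k(1) fS, symmetric])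
    also have "\<dots> \<le> measure lebesgue (corner s :: (real ^ 'n) set)"
    proof (rule measure_mono_fmeasurable[OF _ _ corner_lmeasurable])
      show "?cells ?S \<subseteq> corner s"
      proof
        fix u assume "u \<in> ?cells ?S"
        then obtain x where x: "x \<in> ?G" "coord_sum x < M" "u \<in> cell k x" by blast
        have "real k * (\<Sum>i\<in>UNIV. u $ i) < real k * s"
          using cell_coord_sum(2)[OF x(3)] x(2) M(2) by (simp add: mult.commute)
        then have "(\<Sum>i\<in>UNIV. u $ i) < s" using k(1) by simp
        then show "u \<in> corner s" using cell_subset_half_cube[OF k(1) x(1)] x(3) unfolding corner_def by blast
      qed
      show "?cells ?S \<in> sets lebesgue" using measure_cells(1)[OF k(1) fS] by (rule fmeasurableD)
    qed
    also have "\<dots> \<le> card A * ?m" using le \<Omega>_le by simp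
    finally show ?thesis using mpos by simp
  qed
  from grid_isoperimetry[OF A M(1) this, of t]
  have grid_le: "card {x \<in> ?G. coord_sum x + ?n \<le> M + t} \<le> card ((nbhd ?G grid_adj ^^ t) A)" .
  let ?S = "{x \<in> ?G. coord_sum x + ?n \<le> M + t}" and ?T = "(nbhd ?G grid_adj ^^ t) A"
  have TG: "?T \<subseteq> ?G" by (rule nbhd_funpow_subset[OF A])
  have fS: "finite ?S" by (rule finG) blast
  have fT: "finite ?T" by (rule finG[OF TG])
  have "measure lebesgue (corner (s + r - (3 * ?n + 3) / real k) :: (real ^ 'n) set)
      \<le> measure lebesgue (?cells ?S)"
  proof (rule measure_mono_fmeasurable[OF _ _ measure_cells(1)[OF k(1) fS]])
    show "corner (s + r - (3 * ?n + 3) / real k) \<subseteq> ?cells ?S"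
    proof
      fix u :: "real ^ 'n" assume u: "u \<in> corner (s + r - (3 * ?n + 3) / real k)"
      then obtain x where x: "x \<in> ?G" "u \<in> cell k x"
        using half_cube_cell[OF k(1), of u] unfolding corner_def by blast
      have "real k * (\<Sum>i\<in>UNIV. u $ i) < real k * (s + r - (3 * ?n + 3) / real k)"
        using u k(1) unfolding corner_def by simp
      also have "\<dots> = s * real k + r * real k - (3 * real ?n + 3)"
        using k(1) by (simp add: field_simps)
      finally have "real (coord_sum x) + ?n < real M + real t"
        using cell_coord_sum(1)[OF x(2)] M(3) t(2) by linarith
      then have "coord_sum x + ?n \<le> M + t" by linarith
      then show "u \<in> ?cells ?S" using x by blast
    qed
    show "corner (s + r - (3 * ?n + 3) / real k) \<in> sets (lebesgue :: (real ^ 'n) measure)"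
      using corner_lmeasurable by (rule fmeasurableD)
  qed
  also have "\<dots> = card ?S * ?m" by (rule measure_cells(2)[OF k(1) fS])
  also have "\<dots> \<le> card ?T * ?m" using grid_le by (intro mult_right_mono) auto
  also have "\<dots> = measure lebesgue (?cells ?T)" by (rule measure_cells(2)[OF k(1) fT, symmetric])
  also have "\<dots> \<le> measure lebesgue (l1_nbhd r \<Omega>)"
  proof (rule measure_mono_fmeasurable[OF _ _ l1_nbhd_lmeasurable[OF ne]])
    show "?cells ?T \<subseteq> l1_nbhd r \<Omega>"
    proof
      fix u assume "u \<in> ?cells ?T"
      then obtain x where x: "x \<in> ?T" "u \<in> cell k x" by blast
      obtain y where y: "y \<in> A" "(\<Sum>i\<in>UNIV. \<bar>real (x i) - real (y i)\<bar>) \<le> real t"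
        using nbhd_funpow_dist[OF x(1)] by blast
      then obtain w where w: "w \<in> \<Omega>" "w \<in> cell k y" unfolding A_def by blast
      have "real k * l1_dist u w < real k * r"
        using l1_dist_cells[OF k(1) x(2) w(2)] y(2) t(1) by (simp add: mult.commute)
      then have "l1_dist u w < r" using k(1) by simp
      moreover have "u \<in> unit_cube"
        using cell_subset_half_cube[OF k(1)] x TG half_cube_subset by blast
      ultimately show "u \<in> l1_nbhd r \<Omega>"
        using w(1) l1_infdist_less_iff[OF ne] unfolding l1_nbhd_def by blast
    qed
    show "?cells ?T \<in> sets lebesgue" using measure_cells(1)[OF k(1) fT] by (rule fmeasurableD)
  qed
  finally show ?thesis .
qed

text \<open>
  The sets \<open>corner c\<close> increase to \<open>corner (s + r)\<close> as \<open>c\<close> increases to \<open>s + r\<close>, so the approximate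
  inequality passes to the limit by continuity of the measure from below.
\<close>

lemma corner_enlargement:
  fixes \<Omega> :: "(real ^ 'n::finite) set"
  assumes \<Omega>: "\<Omega> \<subseteq> unit_cube" "\<Omega> \<in> lmeasurable" and pos: "measure lebesgue \<Omega> > 0"
    and le: "measure lebesgue (corner s :: (real ^ 'n) set) \<le> measure lebesgue \<Omega>"
    and s: "s > 0" and r: "r > 0"
  shows "measure lebesgue (corner (s + r) :: (real ^ 'n) set) \<le> measure lebesgue (l1_nbhd r \<Omega>)"
proof -
  let ?C = "3 * real CARD('n) + 3"
  obtain k0 :: nat where k0: "k0 > 0" "2 * real CARD('n) / s \<le> k0" "(real CARD('n) + 1) / r \<le> k0"
  proof -
    obtain k0 :: nat where "max 1 (max (2 * real CARD('n) / s) ((real CARD('n) + 1) / r)) \<le> real k0"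
      using real_arch_simple by blast
    then show ?thesis by (intro that[of k0]) auto
  qed
  let ?c = "\<lambda>j. s + r - ?C / real (k0 + j)"
  let ?F = "\<lambda>j. corner (?c j) :: (real ^ 'n) set"
  have "measure lebesgue (?F j) \<le> measure lebesgue (l1_nbhd r \<Omega>)" for j
  proof -
    have "2 * real CARD('n) \<le> s * real k0" "real CARD('n) + 1 \<le> r * real k0"
      using k0 s r by (simp_all add: field_simps)
    moreover have "s * real k0 \<le> s * real (k0 + j)" "r * real k0 \<le> r * real (k0 + j)"
      using s r by simp_all
    ultimately show ?thesis
      using k0(1) corner_enlargement_approx[OF \<Omega> pos le, of "k0 + j" r] by simp
  qed
  moreover have U: "(\<Union>j. ?F j) = corner (s + r)"
  proof
    show "(\<Union>j. ?F j) \<subseteq> corner (s + r)"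
      by (intro UN_least corner_mono) simp
    show "corner (s + r) \<subseteq> (\<Union>j. ?F j)"
    proof
      fix u :: "real ^ 'n" assume u: "u \<in> corner (s + r)"
      define d where "d = s + r - (\<Sum>i\<in>UNIV. u $ i)"
      have d: "d > 0" using u unfolding corner_def d_def by simp
      obtain j :: nat where j: "?C / d < real j" using reals_Archimedean2 by blast
      have "?C / real (k0 + j) < d"
      proof -
        have "?C < d * real j" using j d by (simp add: field_simps)
        also have "\<dots> \<le> d * real (k0 + j)" using d by simp
        finally show ?thesis using k0(1) by (simp add: field_simps)
      qed
      then have "u \<in> ?F j" using u unfolding corner_def d_def by simp
      then show "u \<in> (\<Union>j. ?F j)" by blast
    qed
  qed
  moreover have "(\<lambda>j. measure lebesgue (?F j)) \<longlonglongrightarrow> measure lebesgue (\<Union>j. ?F j)"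
  proof (rule Lim_measure_incseq)
    show "range ?F \<subseteq> sets lebesgue" using fmeasurableD[OF corner_lmeasurable] by blast
    have "?c i \<le> ?c j" if "i \<le> j" for i j
      using that k0(1) by (intro diff_left_mono divide_left_mono) auto
    then show "incseq ?F" unfolding incseq_def by (intro allI impI corner_mono)
    show "emeasure lebesgue (\<Union>j. ?F j) \<noteq> \<infinity>"
      unfolding U emeasure_eq_measure2[OF corner_lmeasurable] by simp
  qed
  ultimately show ?thesis by (metis (mono_tags, lifting) LIMSEQ_le_const2)
qed

theorem corollary1p11:
  fixes \<Omega> B :: "(real ^ 'n) set" and r :: real
  assumes "closed \<Omega>" and "\<Omega> \<subseteq> unit_cube" and "emeasure lebesgue \<Omega> > 0"
    and "is_l1_ball 0 B" and "emeasure lebesgue B = emeasure lebesgue \<Omega>"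
    and "r > 0"
  shows "emeasure (restrict_space lebesgue unit_cube) (l1_nbhd r \<Omega>)
       \<ge> emeasure (restrict_space lebesgue unit_cube) (l1_nbhd r B)"
proof -
  have \<Omega>m: "\<Omega> \<in> lmeasurable"
    using assms(1,2) by (intro unit_cube_subset_lmeasurable) auto
  have e\<Omega>: "emeasure lebesgue \<Omega> = ennreal (measure lebesgue \<Omega>)"
    by (rule emeasure_eq_measure2[OF \<Omega>m])
  have pos: "measure lebesgue \<Omega> > 0" using assms(3) unfolding e\<Omega> by simp
  have ne: "\<Omega> \<noteq> {}" using pos by auto
  have cube_sets: "unit_cube \<in> sets (lebesgue :: (real ^ 'n) measure)"
    unfolding unit_cube_eq_cbox by simp
  have restrict: "emeasure (restrict_space lebesgue unit_cube) (l1_nbhd r S) = emeasure lebesgue (l1_nbhd r S)"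
    for S :: "(real ^ 'n) set"
    using cube_sets by (intro emeasure_restrict_space) (auto simp: l1_nbhd_def)
  have zero: "(0 :: real ^ 'n) \<in> unit_cube" unfolding unit_cube_def by simp
  have norm1: "l1_dist 0 u = (\<Sum>i\<in>UNIV. u $ i)" if "u \<in> unit_cube" for u :: "real ^ 'n"
    using that unfolding l1_dist_def unit_cube_def by (intro sum.cong) auto
  obtain s where s: "s > 0" and B: "B = Metric_space.mball unit_cube l1_dist 0 s \<or>
      B = Metric_space.mcball unit_cube l1_dist 0 s"
    using assms(4) unfolding is_l1_ball_def by blast
  \<comment> \<open>Whether the ball is open or closed, it lies between \<open>corner s\<close> and the closed simplex of size \<open>s\<close>.\<close>
  have inner: "corner s \<subseteq> B"
  proof
    fix u :: "real ^ 'n" assume u: "u \<in> corner s"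
    then have "u \<in> unit_cube" using half_cube_subset unfolding corner_def by blast
    then show "u \<in> B"
      using B u zero norm1[of u] unfolding corner_def
      by (auto simp: Metric_space.in_mball[OF Metric_space_unit_cube]
          Metric_space.in_mcball[OF Metric_space_unit_cube])
  qed
  have outer: "u \<in> unit_cube \<and> (\<Sum>i\<in>UNIV. u $ i) \<le> s" if "u \<in> B" for u
    using B that norm1[of u]
    by (auto simp: Metric_space.in_mball[OF Metric_space_unit_cube]
        Metric_space.in_mcball[OF Metric_space_unit_cube])
  have "0 \<in> B"
    using B s zero norm1[of 0]
    by (auto simp: Metric_space.in_mball[OF Metric_space_unit_cube]
        Metric_space.in_mcball[OF Metric_space_unit_cube])
  then have Bne: "B \<noteq> {}" by blast
  \<comment> \<open>A set that is not measurable has measure 0 by convention, whereas \<open>B\<close> has positive measure.\<close>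
  have "B \<in> sets lebesgue"
    using assms(3,5) emeasure_notin_sets[of B lebesgue] by (cases "B \<in> sets lebesgue") auto
  then have "emeasure lebesgue (corner s :: (real ^ 'n) set) \<le> emeasure lebesgue \<Omega>"
    unfolding assms(5)[symmetric] by (rule emeasure_mono[OF inner])
  then have "measure lebesgue (corner s :: (real ^ 'n) set) \<le> measure lebesgue \<Omega>"
    unfolding e\<Omega> emeasure_eq_measure2[OF corner_lmeasurable] by simp
  then have main: "measure lebesgue (corner (s + r) :: (real ^ 'n) set) \<le> measure lebesgue (l1_nbhd r \<Omega>)"
    using corner_enlargement[OF assms(2) \<Omega>m pos _ s assms(6)] by blast
  have "l1_nbhd r B \<subseteq> corner (s + r) \<union> (unit_cube - half_cube)"
  proof
    fix u assume u: "u \<in> l1_nbhd r B"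
    then obtain w where w: "w \<in> B" "l1_dist u w < r"
      using l1_infdist_less_iff[OF Bne] unfolding l1_nbhd_def by blast
    have "(\<Sum>i\<in>UNIV. u $ i) \<le> (\<Sum>i\<in>UNIV. w $ i + \<bar>u $ i - w $ i\<bar>)"
      by (intro sum_mono) linarith
    then have "(\<Sum>i\<in>UNIV. u $ i) < s + r"
      using outer[OF w(1)] w(2) unfolding l1_dist_def by (simp add: sum.distrib)
    then show "u \<in> corner (s + r) \<union> (unit_cube - half_cube)"
      using u unfolding l1_nbhd_def corner_def by blast
  qed
  moreover have null: "unit_cube - half_cube \<in> null_sets (lebesgue :: (real ^ 'n) measure)"
    using negligible_unit_cube_diff negligible_iff_null_sets by blast
  ultimately have "emeasure lebesgue (l1_nbhd r B)
      \<le> emeasure lebesgue (corner (s + r) \<union> (unit_cube - half_cube) :: (real ^ 'n) set)"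
    using fmeasurableD[OF corner_lmeasurable] by (intro emeasure_mono) auto
  also have "\<dots> = emeasure lebesgue (corner (s + r) :: (real ^ 'n) set)"
    by (rule emeasure_Un_null_set[OF fmeasurableD[OF corner_lmeasurable] null])
  also have "\<dots> \<le> emeasure lebesgue (l1_nbhd r \<Omega>)"
    unfolding emeasure_eq_measure2[OF corner_lmeasurable] emeasure_eq_measure2[OF l1_nbhd_lmeasurable[OF ne]]
    using main by (rule ennreal_leI)
  finally show ?thesis unfolding restrict .
qed

end
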